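(* Let $(T,r)$ be a compact $\mathbb{R}$-tree and $\nu$ a Radon measure on $(T,\mathcal{B}(T))$ (finite on compact sets and positive on every open ball). For all $b\in T$, $$\frac{1}{2\,\mathrm{diam}^{(T,r)}(T)\cdot\nu(T)}\ \le\ \lambda_{\{b\}}(T)\ \le\ \frac12\inf_{x\in T\setminus\{b\}}\Big(\nu\{y\in T:x\in[y,b]\}\cdot r(x,b)\Big)^{-1},$$ where $\lambda_{\{b\}}(T):=\inf\{\mathcal{E}(f,f):f\in\bar{\mathcal{D}}_{\{b\}}(\mathcal{E}),\ \int f^2\,\mathrm{d}\nu=1\}$ is the principal eigenvalue with respect to $\{b\}$ and $\mathrm{diam}^{(T,r)}(T)=\sup\{r(x,y):x,y\in T\}$.
   Context: An $\mathbb{R}$-tree is a metric space $(T,r)$ such that (1) for all $u,v\in T$ there is a unique isometric embedding $\phi_{u,v}:[0,r(u,v)]\to T$ with $\phi_{u,v}(0)=u$, $\phi_{u,v}(r(u,v))=v$; (2) every injective continuous $\kappa:[0,1]\to T$ satisfies $\kappa([0,1])=\phi_{\kappa(0),\kappa(1)}([0,r(\kappa(0),\kappa(1))])$. Write $[a,b]=\phi_{a,b}([0,r(a,b)])$ and $]a,b[=\phi_{a,b}(]0,r(a,b)[)$. For $a,b,x\in T$, $c(a,b,x)$ is the unique point with $[a,x]\cap[a,b]=[a,c(a,b,x)]$. Length measure: locally compact $\mathbb{R}$-trees are separable; $\lambda=\lambda^{(T,r)}$ is the unique $\sigma$-finite Borel measure on $T$ with $\lambda(]a,b[)=r(a,b)$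 for all $a,b\in T$ and $\lambda(T\setminus T^o)=0$, where $T^o=\bigcup_{a,b\in T}]a,b[$. Gradient: fix a root $\rho\in T$, put $x\wedge y:=c(\rho,x,y)$ and $\int_x^y\lambda(\mathrm{d}z)\,g(z):=-\int_{[x\wedge y,x]}g\,\mathrm{d}\lambda+\int_{[x\wedge y,y]}g\,\mathrm{d}\lambda$. A continuous $f:T\to\mathbb{R}$ is locally absolutely continuous ($f\in\mathcal{A}$) if for every $\varepsilon>0$ and every $S\subseteq T$ with $\lambda(S)<\infty$ there is $\delta>0$ such that for disjoint arcs $[x_1,y_1],\dots,[x_n,y_n]\subseteq S$ with $\sum_i r(x_i,y_i)<\delta$ one has $\sum_i|f(x_i)-f(y_i)|<\varepsilon$. For $f\in\mathcal{A}$, $\nabla f$ is the $\lambda$-a.e. unique function with $f(y)-f(x)=\int_x^y\lambda(\mathrm{d}z)\,\nabla f(z)$ for all $x,y\in T$. Form: $\mathcal{C}_\infty(T)$ is the set of continuous $f:T\to\mathbb{R}$ such that for every $\varepsilon>0$ there is a compact $K$ with $|f|\le\varepsilon$ on $T\setminus K$ (all of $\mathcal{C}(T)$ for compact $T$). $\mathcal{F}:=\{f\in\mathcal{A}:\nabla f\in L^2(\lambda)\}$, $\mathcal{D}(\mathcal{E}):=\mathcal{F}\cap L^2(\nu)\cap\mathcal{C}_\infty(T)$, and $\mathcal{E}(f,g):=\frac12\int\lambda(\mathrm{d}z)\,\nabla f(z)\nabla g(z)$ (independent of the choice of $\rho$). For closed $A\subseteq T$, $\mathcal{D}_A(\mathcal{E}):=\{f\in\mathcal{D}(\mathcal{E}):f|_A=0\}$.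 $\bar{\mathcal{D}}_A(\mathcal{E})$ is the family of Borel functions $f$ on $T$, finite $\nu$-a.e., for which there is an $\mathcal{E}$-Cauchy sequence $(f_n)$ in $\mathcal{D}_A(\mathcal{E})$ with $f_n\to f$ $\nu$-a.e. (functions identified with their continuous versions, $\mathcal{E}$ extended by limits). Convention: $0^{-1}=\infty$. *)

theory Defs
  imports "HOL-Analysis.Analysis"
begin

text \<open>
  The tree is the whole carrier of a type. A geodesic is a function on \<open>{0..dist u v}\<close> only, so
  uniqueness is stated for functions that are \<open>extensional\<close> on that interval.
\<close>

definition is_geodesic :: "'a::metric_space \<Rightarrow> 'a \<Rightarrow> (real \<Rightarrow> 'a) \<Rightarrow> bool" where
  "is_geodesic u v \<phi> \<longleftrightarrow>
     \<phi> \<in> extensional {0..dist u v} \<and>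
     (\<forall>s\<in>{0..dist u v}. \<forall>t\<in>{0..dist u v}. dist (\<phi> s) (\<phi> t) = \<bar>s - t\<bar>) \<and>
     \<phi> 0 = u \<and> \<phi> (dist u v) = v"

definition geodesic :: "'a::metric_space \<Rightarrow> 'a \<Rightarrow> real \<Rightarrow> 'a" where
  "geodesic u v = (THE \<phi>. is_geodesic u v \<phi>)"

definition tree_arc :: "'a::metric_space \<Rightarrow> 'a \<Rightarrow> 'a set" where
  "tree_arc a b = geodesic a b ` {0..dist a b}"

definition open_tree_arc :: "'a::metric_space \<Rightarrow> 'a \<Rightarrow> 'a set" where
  "open_tree_arc a b = geodesic a b ` {0<..<dist a b}"

class real_tree = metric_space +
  assumes unique_geodesic: "\<exists>!\<phi>. is_geodesic u v \<phi>"
    and injective_path_image: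
      "\<lbrakk>continuous_on {0..1::real} \<kappa>; inj_on \<kappa> {0..1}\<rbrakk> \<Longrightarrow> \<kappa> ` {0..1} = tree_arc (\<kappa> 0) (\<kappa> 1)"

definition branch_point :: "'a::real_tree \<Rightarrow> 'a \<Rightarrow> 'a \<Rightarrow> 'a" where
  "branch_point a b x = (THE c. tree_arc a x \<inter> tree_arc a b = tree_arc a c)"

definition skeleton :: "'a::real_tree set" where
  "skeleton = (\<Union>a b. open_tree_arc a b)"

definition is_length_measure :: "'a::real_tree measure \<Rightarrow> bool" where
  "is_length_measure M \<longleftrightarrow>
     sets M = sets borel \<and> sigma_finite_measure M \<and>
     (\<forall>a b. emeasure M (open_tree_arc a b) = ennreal (dist a b)) \<and>
     - skeleton \<in> null_sets M"

text \<open>Meaningful for separable trees, where such a measure exists and is unique.\<close>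

definition length_measure :: "'a::real_tree measure" where
  "length_measure = (THE M. is_length_measure M)"

text \<open>In the remaining definitions \<open>\<rho>\<close> is the root; it only fixes the sign of gradients.\<close>

definition meet :: "'a::real_tree \<Rightarrow> 'a \<Rightarrow> 'a \<Rightarrow> 'a" where
  "meet \<rho> x y = branch_point \<rho> x y"

definition tree_integral :: "'a::real_tree \<Rightarrow> ('a \<Rightarrow> real) \<Rightarrow> 'a \<Rightarrow> 'a \<Rightarrow> real" where
  "tree_integral \<rho> g x y =
     - set_lebesgue_integral length_measure (tree_arc (meet \<rho> x y) x) g
     + set_lebesgue_integral length_measure (tree_arc (meet \<rho> x y) y) g"

text \<open>
  The set \<open>S\<close> has to be Borel here: \<^const>\<open>emeasure\<close> is \<open>0\<close> on non-measurable sets.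
\<close>

definition locally_abs_continuous :: "('a::real_tree \<Rightarrow> real) \<Rightarrow> bool" where
  "locally_abs_continuous f \<longleftrightarrow>
     continuous_on UNIV f \<and>
     (\<forall>\<epsilon>>0. \<forall>S\<in>sets borel. emeasure length_measure S < \<infinity> \<longrightarrow>
       (\<exists>\<delta>>0. \<forall>n::nat. \<forall>x y.
          disjoint_family_on (\<lambda>i. tree_arc (x i) (y i)) {..<n} \<longrightarrow>
          (\<forall>i<n. tree_arc (x i) (y i) \<subseteq> S) \<longrightarrow>
          (\<Sum>i<n. dist (x i) (y i)) < \<delta> \<longrightarrow>
          (\<Sum>i<n. \<bar>f (x i) - f (y i)\<bar>) < \<epsilon>))"

text \<open>
  Integrability along arcs is explicit because non-convergent Bochner integrals are \<open>0\<close>.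
\<close>

definition has_gradient :: "'a::real_tree \<Rightarrow> ('a \<Rightarrow> real) \<Rightarrow> ('a \<Rightarrow> real) \<Rightarrow> bool" where
  "has_gradient \<rho> f g \<longleftrightarrow>
     g \<in> borel_measurable borel \<and>
     (\<forall>x y. set_integrable length_measure (tree_arc x y) g) \<and>
     (\<forall>x y. f y - f x = tree_integral \<rho> g x y)"

definition gradient :: "'a::real_tree \<Rightarrow> ('a \<Rightarrow> real) \<Rightarrow> 'a \<Rightarrow> real" where
  "gradient \<rho> f = (SOME g. has_gradient \<rho> f g)"

definition square_integrable :: "'a measure \<Rightarrow> ('a \<Rightarrow> real) \<Rightarrow> bool" where
  "square_integrable M f \<longleftrightarrow> f \<in> borel_measurable M \<and> integrable M (\<lambda>x. (f x)\<^sup>2)"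

definition vanishing_at_infinity :: "('a::topological_space \<Rightarrow> real) \<Rightarrow> bool" where
  "vanishing_at_infinity f \<longleftrightarrow>
     continuous_on UNIV f \<and> (\<forall>\<epsilon>>0. \<exists>K. compact K \<and> (\<forall>x\<in>-K. \<bar>f x\<bar> \<le> \<epsilon>))"

text \<open>
  Every locally absolutely continuous function has a gradient, unique up to length-null sets. The
  first conjunct about gradients records that the choice in \<^const>\<open>gradient\<close> is a proper one.
\<close>

definition finite_energy :: "'a::real_tree \<Rightarrow> ('a \<Rightarrow> real) set" where
  "finite_energy \<rho> =
     {f. locally_abs_continuous f \<and> has_gradient \<rho> f (gradient \<rho> f) \<and>
         square_integrable length_measure (gradient \<rho> f)}"

definition form_domain :: "'a::real_tree \<Rightarrow> 'a measure \<Rightarrow> ('a \<Rightarrow> real) set" where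
  "form_domain \<rho> \<nu> =
     {f \<in> finite_energy \<rho>. square_integrable \<nu> f \<and> vanishing_at_infinity f}"

definition form :: "'a::real_tree \<Rightarrow> ('a \<Rightarrow> real) \<Rightarrow> ('a \<Rightarrow> real) \<Rightarrow> real" where
  "form \<rho> f g = 1/2 * (LINT z|length_measure. gradient \<rho> f z * gradient \<rho> g z)"

definition killed_domain :: "'a::real_tree \<Rightarrow> 'a measure \<Rightarrow> 'a set \<Rightarrow> ('a \<Rightarrow> real) set" where
  "killed_domain \<rho> \<nu> A = {f \<in> form_domain \<rho> \<nu>. \<forall>x\<in>A. f x = 0}"

definition form_Cauchy :: "'a::real_tree \<Rightarrow> (nat \<Rightarrow> 'a \<Rightarrow> real) \<Rightarrow> bool" where
  "form_Cauchy \<rho> F \<longleftrightarrow>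
     (\<forall>\<epsilon>>0. \<exists>N. \<forall>m\<ge>N. \<forall>n\<ge>N.
        form \<rho> (\<lambda>x. F m x - F n x) (\<lambda>x. F m x - F n x) < \<epsilon>)"

definition approximating ::
  "'a::real_tree \<Rightarrow> 'a measure \<Rightarrow> 'a set \<Rightarrow> (nat \<Rightarrow> 'a \<Rightarrow> real) \<Rightarrow> ('a \<Rightarrow> ereal) \<Rightarrow> bool" where
  "approximating \<rho> \<nu> A F f \<longleftrightarrow>
     (\<forall>n. F n \<in> killed_domain \<rho> \<nu> A) \<and> form_Cauchy \<rho> F \<and>
     (AE x in \<nu>. (\<lambda>n. ereal (F n x)) \<longlonglongrightarrow> f x)"

definition extended_domain :: "'a::real_tree \<Rightarrow> 'a measure \<Rightarrow> 'a set \<Rightarrow> ('a \<Rightarrow> ereal) set" where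
  "extended_domain \<rho> \<nu> A =
     {f \<in> borel_measurable borel. (AE x in \<nu>. \<bar>f x\<bar> \<noteq> \<infinity>) \<and> (\<exists>F. approximating \<rho> \<nu> A F f)}"

text \<open>
  \<open>has_energy \<rho> \<nu> A f e\<close> says that \<open>e\<close> is the value at \<open>(f, f)\<close> of the form extended by limits;
  this value does not depend on the approximating sequence.
\<close>

definition has_energy ::
  "'a::real_tree \<Rightarrow> 'a measure \<Rightarrow> 'a set \<Rightarrow> ('a \<Rightarrow> ereal) \<Rightarrow> real \<Rightarrow> bool" where
  "has_energy \<rho> \<nu> A f e \<longleftrightarrow>
     (\<exists>F. approximating \<rho> \<nu> A F f \<and> (\<lambda>n. form \<rho> (F n) (F n)) \<longlonglongrightarrow> e)"

definition principal_eigenvalue :: "'a::real_tree \<Rightarrow> 'a measure \<Rightarrow> 'a set \<Rightarrow> ennreal" where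
  "principal_eigenvalue \<rho> \<nu> A =
     Inf {ennreal e | f e. f \<in> extended_domain \<rho> \<nu> A \<and> has_energy \<rho> \<nu> A f e \<and>
            (\<integral>\<^sup>+x. e2ennreal ((f x)\<^sup>2) \<partial>\<nu>) = 1}"

definition radon_full_support :: "'a::metric_space measure \<Rightarrow> bool" where
  "radon_full_support \<nu> \<longleftrightarrow>
     sets \<nu> = sets borel \<and> (\<forall>K. compact K \<longrightarrow> emeasure \<nu> K < \<infinity>) \<and>
     (\<forall>x. \<forall>\<epsilon>>0. 0 < emeasure \<nu> (ball x \<epsilon>))"

end

theory Submission
  imports Defs
begin

text \<open>
  If \<open>f b = 0\<close>, then \<open>f x\<close> is the integral of the gradient of \<open>f\<close>, up to sign, over the arc from
  \<open>b\<close> to \<open>x\<close>. Cauchy--Schwarz gives \<open>(f x)\<^sup>2 \<le> 2 r(b, x) \<E>(f, f)\<close>, and integrating this against \<open>\<nu>\<close>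
  gives the lower bound. For the upper bound, test with a multiple of
  \<open>h y = (r(b, y) + r(b, x) - r(x, y)) / 2\<close>: it vanishes at \<open>b\<close>, has energy \<open>r(x, b) / 2\<close>, and equals
  \<open>r(x, b)\<close> at every \<open>y\<close> with \<open>x \<in> [y, b]\<close>.

  The length measure is determined by its values on arcs from a root, because countably many of
  them cover the skeleton; conversely, the images of Lebesgue measure on these arcs agree on
  overlaps and so glue to a length measure.
\<close>

section \<open>Arcs and tripods\<close>

text \<open>\<open>length_measure\<close> and \<open>gradient\<close> are picked by
  \<open>THE\<close> and \<open>SOME\<close>, so nothing can be computed with them before existence
  and uniqueness are settled. The lower bound works with whatever gradient is chosen. The upper
  bound needs the exact energy of \<open>h\<close>, hence almost-everywhere uniqueness of gradients,
  so that an explicit gradient, which is plus or minus 1 on the arc from \<open>b\<close> to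
  \<open>x\<close>, may stand in for the chosen one. The geometry rests on one reformulation:
  \<open>p\<close> lies on the arc from \<open>a\<close> to \<open>b\<close> iff
  \<open>dist a p + dist p b = dist a b\<close>. Most statements about arcs then become linear
  arithmetic on distances. The axiom on injective paths enters only to produce the center of a
  tripod. As for the constants: Cauchy--Schwarz along one arc costs its length, at most the
  diameter, and the factor 1/2 in \<open>form\<close> turns into the 2. In the upper bound only the
  mass behind \<open>x\<close>, where \<open>h\<close> is constant, is counted in the integral of
  the square of \<open>h\<close>; this is the one place where that estimate loses.\<close>

lemma is_geodesic_geodesic: "is_geodesic u v (geodesic u (v::'a::real_tree))"
  unfolding geodesic_def using unique_geodesic[of u v] by (rule theI')

lemma geodesic_unique: "is_geodesic u (v::'a::real_tree) \<phi> \<Longrightarrow> geodesic u v = \<phi>"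
  using unique_geodesic is_geodesic_geodesic by blast

lemma
  fixes u v :: "'a::real_tree"
  shows geodesic_0 [simp]: "geodesic u v 0 = u"
    and geodesic_dist [simp]: "geodesic u v (dist u v) = v"
    and dist_geodesic: "s \<in> {0..dist u v} \<Longrightarrow> t \<in> {0..dist u v} \<Longrightarrow>
           dist (geodesic u v s) (geodesic u v t) = \<bar>s - t\<bar>"
  using is_geodesic_geodesic[of u v] unfolding is_geodesic_def by auto

lemma
  fixes u v :: "'a::real_tree"
  assumes "t \<in> {0..dist u v}"
  shows dist_geodesic_start: "dist u (geodesic u v t) = t"
    and dist_geodesic_end: "dist (geodesic u v t) v = dist u v - t"
  using dist_geodesic[of 0 u v t] dist_geodesic[of t u v "dist u v"] assms by auto

text \<open>The triangle inequality through \<open>p\<close> bounds all distances along the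
  concatenation from above. A strict inequality anywhere would give a shortcut from \<open>a\<close>
  to \<open>b\<close>, so all these bounds are equalities.\<close>

lemma concat_geodesic:
  fixes a b p :: "'a::real_tree"
  assumes "dist a p + dist p b = dist a b"
  shows "is_geodesic a b (restrict (\<lambda>t. if t \<le> dist a p then geodesic a p t
           else geodesic p b (t - dist a p)) {0..dist a b})"
proof -
  define \<phi> where "\<phi> t = (if t \<le> dist a p then geodesic a p t else geodesic p b (t - dist a p))" for t
  have start: "dist a (\<phi> t) \<le> t" and end': "dist (\<phi> t) b \<le> dist a b - t" if "t \<in> {0..dist a b}" for t
  proof -
    show "dist a (\<phi> t) \<le> t"
      using that assms dist_geodesic_start[of t a p] dist_geodesic_start[of "t - dist a p" p b]
        dist_triangle[of a "\<phi> t" p]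
      by (auto simp: \<phi>_def split: if_splits)
    show "dist (\<phi> t) b \<le> dist a b - t"
      using that assms dist_geodesic_end[of t a p] dist_geodesic_end[of "t - dist a p" p b]
        dist_triangle[of "\<phi> t" b p]
      by (auto simp: \<phi>_def split: if_splits)
  qed
  have upper: "dist (\<phi> s) (\<phi> t) \<le> t - s" if "s \<in> {0..dist a b}" "t \<in> {0..dist a b}" "s \<le> t" for s t
    using that assms dist_geodesic[of s a p t] dist_geodesic[of "s - dist a p" p b "t - dist a p"]
      dist_geodesic_end[of s a p] dist_geodesic_start[of "t - dist a p" p b]
      dist_triangle[of "\<phi> s" "\<phi> t" p]
    by (auto simp: \<phi>_def split: if_splits)
  have mono: "dist (\<phi> s) (\<phi> t) = t - s" if "s \<in> {0..dist a b}" "t \<in> {0..dist a b}" "s \<le> t" for s t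
    using upper[OF that] start[OF that(1)] end'[OF that(2)]
      dist_triangle[of a b "\<phi> s"] dist_triangle[of "\<phi> s" b "\<phi> t"] by linarith
  have iso: "dist (\<phi> s) (\<phi> t) = \<bar>s - t\<bar>" if "s \<in> {0..dist a b}" "t \<in> {0..dist a b}" for s t
    using mono[of s t] mono[of t s] that by (cases "s \<le> t") (auto simp: dist_commute)
  have "\<phi> 0 = a" by (simp add: \<phi>_def)
  moreover have "\<phi> (dist a b) = b"
    using end'[of "dist a b"] by (simp del: zero_less_dist_iff)
  ultimately show ?thesis
    unfolding is_geodesic_def \<phi>_def[symmetric] using iso by (auto simp: \<phi>_def[symmetric])
qed

text \<open>Conversely, if the distances add up, the concatenation through \<open>p\<close> is a
  geodesic. By uniqueness it is the geodesic, which therefore visits \<open>p\<close>.\<close>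

lemma mem_tree_arc_iff:
  fixes a b p :: "'a::real_tree"
  shows "p \<in> tree_arc a b \<longleftrightarrow> dist a p + dist p b = dist a b"
proof
  assume "p \<in> tree_arc a b"
  then show "dist a p + dist p b = dist a b"
    unfolding tree_arc_def using dist_geodesic_start dist_geodesic_end by fastforce
next
  assume eq: "dist a p + dist p b = dist a b"
  have "geodesic a b (dist a p) = p"
    using geodesic_unique[OF concat_geodesic[OF eq]] eq[symmetric] by simp
  moreover have "dist a p \<in> {0..dist a b}"
    using eq zero_le_dist[of p b] zero_le_dist[of a p] unfolding atLeastAtMost_iff by linarith
  ultimately show "p \<in> tree_arc a b"
    unfolding tree_arc_def by (metis imageI)
qed

lemma tree_arc_commute: "tree_arc a b = tree_arc b (a::'a::real_tree)"
  by (auto simp: mem_tree_arc_iff dist_commute add.commute)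

lemma ends_in_tree_arc [simp]: "a \<in> tree_arc a (b::'a::real_tree)" "b \<in> tree_arc a b"
  by (auto simp: mem_tree_arc_iff)

lemma geodesic_in_tree_arc: "t \<in> {0..dist a b} \<Longrightarrow> geodesic a b t \<in> tree_arc a b"
  unfolding tree_arc_def by auto

lemma geodesic_dist_start:
  fixes a b p :: "'a::real_tree"
  assumes "p \<in> tree_arc a b"
  shows "geodesic a b (dist a p) = p"
proof -
  obtain s where "s \<in> {0..dist a b}" "p = geodesic a b s"
    using assms unfolding tree_arc_def by auto
  then show ?thesis using dist_geodesic_start by metis
qed

lemma dist_le_tree_arc:
  fixes a b p :: "'a::real_tree"
  shows "p \<in> tree_arc a b \<Longrightarrow> dist a p \<le> dist a b"
  using zero_le_dist[of p b] unfolding mem_tree_arc_iff by linarith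

lemma geodesic_prefix:
  fixes a b p :: "'a::real_tree"
  assumes "p \<in> tree_arc a b" "t \<in> {0..dist a p}"
  shows "geodesic a b t = geodesic a p t"
proof -
  let ?q = "geodesic a p t"
  have "dist a ?q = t" "dist ?q p = dist a p - t"
    using assms dist_geodesic_start dist_geodesic_end by blast+
  then have "?q \<in> tree_arc a b"
    using assms(1) dist_triangle[of ?q b p] dist_triangle[of a b ?q]
    unfolding mem_tree_arc_iff by linarith
  then show ?thesis
    using geodesic_dist_start \<open>dist a ?q = t\<close> by metis
qed

text \<open>Arcs behave like intervals ordered by the distance from their start; this makes arcs
  from a common root comparable by a single number.\<close>

lemma tree_arc_prefix:
  fixes a b p :: "'a::real_tree"
  assumes "p \<in> tree_arc a b"
  shows "tree_arc a p = {q \<in> tree_arc a b. dist a q \<le> dist a p}"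
proof (intro set_eqI iffI)
  fix q assume "q \<in> tree_arc a p"
  then show "q \<in> {q \<in> tree_arc a b. dist a q \<le> dist a p}"
    using assms dist_triangle[of q b p] dist_triangle[of a b q] zero_le_dist[of q p]
    unfolding mem_tree_arc_iff mem_Collect_eq by linarith
next
  fix q assume "q \<in> {q \<in> tree_arc a b. dist a q \<le> dist a p}"
  then show "q \<in> tree_arc a p"
    using geodesic_prefix[OF assms, of "dist a q"] geodesic_dist_start[of q a b]
      geodesic_in_tree_arc[of "dist a q" a p] by auto
qed

lemma continuous_on_geodesic:
  "continuous_on {0..dist a b} (geodesic a (b::'a::real_tree))"
  unfolding continuous_on_iff using dist_geodesic by (metis dist_real_def)

lemma compact_tree_arc: "compact (tree_arc a (b::'a::real_tree))"
  unfolding tree_arc_def by (intro compact_continuous_image continuous_on_geodesic compact_Icc)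

lemma tree_arc_borel [measurable]: "tree_arc a (b::'a::real_tree) \<in> sets borel"
  using compact_tree_arc by (intro borel_compact)

text \<open>Two arcs from \<open>c\<close> that meet only in \<open>c\<close> concatenate to an injective path, hence to an arc.\<close>

lemma mem_tree_arc_if_disjoint:
  fixes c x b :: "'a::real_tree"
  assumes disj: "tree_arc c x \<inter> tree_arc c b = {c}"
  shows "c \<in> tree_arc x b"
proof (cases "x = c \<or> b = c")
  case False
  define p where "p = dist c x"
  define L where "L = dist c x + dist c b"
  \<comment> \<open>The path runs backwards from \<open>x\<close> to \<open>c\<close>, then forwards
    to \<open>b\<close>. It has unit speed up to the factor \<open>L\<close>, its total length, and
    passes \<open>c\<close> at time \<open>p / L\<close>.\<close>
  define \<kappa> where "\<kappa> t = (if t * L \<le> p then geodesic c x (p - t * L) else geodesic c b (t * L - p))" for t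
  have pos: "p > 0" "L > p" "L > 0"
    using False unfolding p_def L_def by (auto intro: add_pos_pos simp: dist_commute)
  have range1: "p - t * L \<in> {0..dist c x}" if "t \<in> {0..1}" "t * L \<le> p" for t
    using that pos by (auto simp: p_def)
  have range2: "t * L - p \<in> {0..dist c b}" if "t \<in> {0..1}" "p \<le> t * L" for t
  proof -
    have "t * L \<le> L" using that pos mult_right_mono[of t 1 L] by simp
    then show ?thesis using that by (simp add: p_def L_def)
  qed
  have "continuous_on {0..1} \<kappa>"
    unfolding \<kappa>_def
  proof (rule continuous_on_cases_le)
    show "continuous_on {t \<in> {0..1}. t * L \<le> p} (\<lambda>t. geodesic c x (p - t * L))"
      by (rule continuous_on_compose2[OF continuous_on_geodesic])
        (use range1 in \<open>auto intro!: continuous_intros\<close>)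
    show "continuous_on {t \<in> {0..1}. p \<le> t * L} (\<lambda>t. geodesic c b (t * L - p))"
      by (rule continuous_on_compose2[OF continuous_on_geodesic])
        (use range2 in \<open>auto intro!: continuous_intros\<close>)
    show "geodesic c x (p - t * L) = geodesic c b (t * L - p)" if "t * L = p" for t
      using that by simp
  qed (intro continuous_intros)
  moreover have inj: "inj_on \<kappa> {0..1}"
  proof (rule inj_onI)
    fix s t :: real assume st: "s \<in> {0..1}" "t \<in> {0..1}" and eq: "\<kappa> s = \<kappa> t"
    have d1: "dist c (\<kappa> t) = p - t * L \<and> \<kappa> t \<in> tree_arc c x" if "t \<in> {0..1}" "t * L \<le> p" for t
      using that(2) dist_geodesic_start[OF range1[OF that]] geodesic_in_tree_arc[OF range1[OF that]]
      by (simp add: \<kappa>_def)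
    have d2: "dist c (\<kappa> t) = t * L - p \<and> \<kappa> t \<in> tree_arc c b" if "t \<in> {0..1}" "p < t * L" for t
      using that(2) dist_geodesic_start[OF range2[of t]] geodesic_in_tree_arc[OF range2[of t]] that(1)
      by (simp add: \<kappa>_def)
    \<comment> \<open>Within one half the distance from \<open>c\<close> determines the time. Across
      the halves a common value lies in both arcs, so it is \<open>c\<close>, at distance 0, and
      both times sit at the junction.\<close>
    have "s * L = t * L"
    proof (cases "s * L \<le> p"; cases "t * L \<le> p")
      assume "s * L \<le> p" "\<not> t * L \<le> p"
      then have "\<kappa> t = c" using d1[of s] d2[of t] st eq disj by (metis IntI not_le singletonD)
      then show ?thesis using d1[of s] d2[of t] st eq \<open>s * L \<le> p\<close> \<open>\<not> t * L \<le> p\<close> by auto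
    next
      assume "\<not> s * L \<le> p" "t * L \<le> p"
      then have "\<kappa> t = c" using d1[of t] d2[of s] st eq disj by (metis IntI not_le singletonD)
      then show ?thesis using d1[of t] d2[of s] st eq \<open>\<not> s * L \<le> p\<close> \<open>t * L \<le> p\<close> by auto
    qed (use d1[of s] d1[of t] d2[of s] d2[of t] st eq in auto)
    then show "s = t" using pos by simp
  qed
  ultimately have "\<kappa> ` {0..1} = tree_arc (\<kappa> 0) (\<kappa> 1)" by (rule injective_path_image)
  moreover have "\<kappa> 0 = x" using pos by (simp add: \<kappa>_def) (simp add: p_def)
  moreover have "\<kappa> 1 = b" using pos by (simp add: \<kappa>_def) (simp add: p_def L_def)
  moreover have "\<kappa> (p / L) = c" "p / L \<in> {0..1}" using pos by (auto simp: \<kappa>_def)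
  ultimately show ?thesis by (metis imageI)
qed auto

text \<open>The center is the point common to both arcs from \<open>a\<close> that is farthest from
  \<open>a\<close>. A point other than \<open>c\<close> shared by the arcs from \<open>c\<close> to
  \<open>x\<close> and to \<open>b\<close> would be common to both and farther still.\<close>

lemma tripod_center:
  fixes a b x :: "'a::real_tree"
  obtains c where "c \<in> tree_arc a x" "c \<in> tree_arc a b" "c \<in> tree_arc x b"
proof -
  let ?S = "tree_arc a x \<inter> tree_arc a b"
  have "compact ?S" by (intro compact_Int compact_tree_arc)
  moreover have "?S \<noteq> {}" using ends_in_tree_arc by fastforce
  ultimately obtain c where c: "c \<in> ?S" and max: "\<And>q. q \<in> ?S \<Longrightarrow> dist a q \<le> dist a c"
    using continuous_attains_sup[of ?S "dist a"] continuous_on_dist[OF continuous_on_const continuous_on_id]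
    by blast
  have "q = c" if "q \<in> tree_arc c x" "q \<in> tree_arc c b" for q
  proof -
    have "q \<in> ?S" "dist a q = dist a c + dist c q"
      using that c dist_triangle[of a q c] dist_triangle[of a x q] dist_triangle[of a b q]
      unfolding mem_tree_arc_iff Int_iff by linarith+
    then show ?thesis using max[of q] by simp
  qed
  then have "tree_arc c x \<inter> tree_arc c b = {c}" by auto
  with c show thesis using mem_tree_arc_if_disjoint that by blast
qed

text \<open>A common point strictly beyond \<open>c\<close> would allow a route from
  \<open>x\<close> to \<open>b\<close> shorter than their distance, which is attained through
  \<open>c\<close>.\<close>

lemma tree_arc_Int:
  fixes a b c x :: "'a::real_tree"
  assumes c: "c \<in> tree_arc a x" "c \<in> tree_arc a b" "c \<in> tree_arc x b"
  shows "tree_arc a x \<inter> tree_arc a b = tree_arc a c"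
proof -
  have "dist a q \<le> dist a c" if q: "q \<in> tree_arc a x" "q \<in> tree_arc a b" for q
    using q c dist_triangle[of x b q] dist_commute[of x q] dist_commute[of x c]
    unfolding mem_tree_arc_iff by linarith
  then show ?thesis
    using tree_arc_prefix[OF c(1)] tree_arc_prefix[OF c(2)] by blast
qed

lemma branch_point_eqI:
  fixes a b c x :: "'a::real_tree"
  assumes "c \<in> tree_arc a x" "c \<in> tree_arc a b" "c \<in> tree_arc x b"
  shows "branch_point a b x = c"
  unfolding branch_point_def
proof (rule the_equality)
  show "tree_arc a x \<inter> tree_arc a b = tree_arc a c" by (rule tree_arc_Int[OF assms])
  fix c' assume "tree_arc a x \<inter> tree_arc a b = tree_arc a c'"
  then have eq: "tree_arc a c = tree_arc a c'" using tree_arc_Int[OF assms] by simp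
  have "c \<in> tree_arc a c'" "c' \<in> tree_arc a c" using eq ends_in_tree_arc(2) by blast+
  then have "dist c c' = 0" using dist_commute[of c c'] zero_le_dist[of c c']
    unfolding mem_tree_arc_iff by linarith
  then show "c' = c" by simp
qed

text \<open>The height of the meet above the root is the Gromov product of \<open>x\<close> and
  \<open>y\<close>. Lengths of intersections of rooted arcs are computed from this formula
  throughout.\<close>

lemma
  fixes \<rho> x y :: "'a::real_tree"
  shows meet_in_tree_arc: "meet \<rho> x y \<in> tree_arc \<rho> x" "meet \<rho> x y \<in> tree_arc \<rho> y"
    and tree_arc_Int_meet: "tree_arc \<rho> x \<inter> tree_arc \<rho> y = tree_arc \<rho> (meet \<rho> x y)"
    and dist_meet: "dist \<rho> (meet \<rho> x y) = (dist \<rho> x + dist \<rho> y - dist x y) / 2"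
proof -
  obtain c where c: "c \<in> tree_arc \<rho> y" "c \<in> tree_arc \<rho> x" "c \<in> tree_arc y x"
    by (rule tripod_center)
  have m: "meet \<rho> x y = c" unfolding meet_def by (rule branch_point_eqI[OF c])
  show "meet \<rho> x y \<in> tree_arc \<rho> x" "meet \<rho> x y \<in> tree_arc \<rho> y"
    "tree_arc \<rho> x \<inter> tree_arc \<rho> y = tree_arc \<rho> (meet \<rho> x y)"
    using c tree_arc_Int[OF c] m by auto
  show "dist \<rho> (meet \<rho> x y) = (dist \<rho> x + dist \<rho> y - dist x y) / 2"
    using c dist_commute[of x y] dist_commute[of c y] unfolding m mem_tree_arc_iff by argo
qed

section \<open>Borel measures on a single arc\<close>

lemma geodesic_vimage_borel:
  fixes a b :: "'a::real_tree"
  assumes "A \<in> sets borel"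
  shows "{t \<in> {0..dist a b}. geodesic a b t \<in> A} \<in> sets borel"
proof -
  have "geodesic a b \<in> borel_measurable (restrict_space borel {0..dist a b})"
    by (intro borel_measurable_continuous_on_restrict continuous_on_geodesic)
  from measurable_sets[OF this assms]
  have "geodesic a b -` A \<inter> {0..dist a b} \<in> sets borel"
    by (subst (asm) sets_restrict_space_iff) (auto simp: space_restrict_space)
  then show ?thesis by (simp add: vimage_def Int_def conj_commute)
qed

text \<open>On \<open>tree_arc a b\<close> the map \<^term>\<open>dist a\<close> is inverse to the geodesic, which reduces the claim to
  measures on the real line that agree on half-lines.\<close>

lemma measure_eq_on_tree_arc:
  fixes M N :: "'a::real_tree measure"
  assumes sets [measurable_cong]: "sets M = sets borel" "sets N = sets borel"
    and fin: "emeasure M (tree_arc a b) < \<infinity>"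
    and eq: "\<And>p. p \<in> tree_arc a b \<Longrightarrow> emeasure M (tree_arc a p) = emeasure N (tree_arc a p)"
    and A: "A \<in> sets borel" "A \<subseteq> tree_arc a b"
  shows "emeasure M A = emeasure N A"
proof -
  define I where "I = tree_arc a b"
  define K where "K L = distr (restrict_space L I) borel (dist a)" for L
  have K: "emeasure (K L) X = emeasure L {q \<in> I. dist a q \<in> X}"
    if "sets L = sets borel" "X \<in> sets borel" for L X
  proof -
    have [simp]: "space L = UNIV" using sets_eq_imp_space_eq[OF that(1)] by simp
    have "dist a \<in> restrict_space L I \<rightarrow>\<^sub>M borel"
      by (intro measurable_restrict_space1) (simp add: measurable_cong_sets[OF that(1) refl]
        borel_measurable_continuous_onI continuous_on_dist continuous_on_const continuous_on_id)
    then have "emeasure (K L) X = emeasure (restrict_space L I) (dist a -` X \<inter> I)"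
      unfolding K_def using that by (simp add: emeasure_distr space_restrict_space)
    also have "\<dots> = emeasure L (dist a -` X \<inter> I)"
      by (rule emeasure_restrict_space) (auto simp: that I_def)
    also have "dist a -` X \<inter> I = {q \<in> I. dist a q \<in> X}" by auto
    finally show ?thesis .
  qed
  have le: "emeasure M B \<le> emeasure M I" if "B \<subseteq> I" for B
    using that by (intro emeasure_mono) (auto simp: I_def)
  have "K M = K N"
  proof (rule measure_eqI_lessThan)
    fix x
    show "emeasure (K M) {x<..} < \<infinity>"
      using le[of "{q \<in> I. x < dist a q}"] fin by (auto simp: K sets I_def intro: le_less_trans)
    show "emeasure (K M) {x<..} = emeasure (K N) {x<..}"
    proof (cases "x < 0")
      case True
      then have "{q \<in> I. x < dist a q} = I" using zero_le_dist less_le_trans by blast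
      then show ?thesis using eq[of b] by (simp add: K sets I_def)
    next
      case False
      \<comment> \<open>Truncation by \<open>min\<close> covers thresholds beyond the end of the
        arc: then \<open>p = b\<close> and both sides of the set equation below are empty.\<close>
      define p where "p = geodesic a b (min x (dist a b))"
      have t: "min x (dist a b) \<in> {0..dist a b}" using False by auto
      have p: "p \<in> tree_arc a b" "dist a p = min x (dist a b)"
        unfolding p_def using geodesic_in_tree_arc[OF t] dist_geodesic_start[OF t] by auto
      have "{q \<in> I. x < dist a q} = I - tree_arc a p"
        unfolding tree_arc_prefix[OF p(1)] p(2) I_def using dist_le_tree_arc by fastforce
      moreover have "emeasure L (I - tree_arc a p) = emeasure L I - emeasure L (tree_arc a p)"
        if "sets L = sets borel" "emeasure L I < \<infinity>" for L
      proof (rule emeasure_Diff)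
        show sub: "tree_arc a p \<subseteq> I" unfolding tree_arc_prefix[OF p(1)] I_def by blast
        show "emeasure L (tree_arc a p) \<noteq> \<infinity>"
          using that emeasure_mono[OF sub, of L] by (auto simp: I_def top_unique)
      qed (simp_all add: that I_def)
      ultimately show ?thesis
        using fin eq[OF p(1)] eq[of b] by (simp add: K sets I_def)
    qed
  qed (auto simp: K_def)
  moreover define B where "B = {t \<in> {0..dist a b}. geodesic a b t \<in> A}"
  moreover have "B \<in> sets borel" unfolding B_def by (rule geodesic_vimage_borel[OF A(1)])
  moreover have "A = {q \<in> I. dist a q \<in> B}"
    using A(2) geodesic_dist_start[of _ a b] dist_le_tree_arc[of _ a b] by (auto simp: I_def B_def)
  ultimately show ?thesis using K[OF sets(1)] K[OF sets(2)] by metis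
qed

section \<open>Reduction of arbitrary arcs to arcs from a root, and countable coverings\<close>

lemma open_tree_arc_eq: "open_tree_arc a b = tree_arc a b - {a, b :: 'a::real_tree}"
proof (intro set_eqI iffI)
  fix p assume "p \<in> open_tree_arc a b"
  then obtain t where "t \<in> {0<..<dist a b}" "p = geodesic a b t"
    unfolding open_tree_arc_def by auto
  then show "p \<in> tree_arc a b - {a, b}"
    using geodesic_in_tree_arc[of t a b] dist_geodesic_start[of t a b] dist_geodesic_end[of t a b]
    by auto
next
  fix p assume p: "p \<in> tree_arc a b - {a, b}"
  then have "dist a p + dist p b = dist a b" "0 < dist a p" "0 < dist p b"
    by (auto simp: mem_tree_arc_iff)
  then have "dist a p \<in> {0<..<dist a b}" unfolding greaterThanLessThan_iff by linarith
  then show "p \<in> open_tree_arc a b"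
    unfolding open_tree_arc_def using p geodesic_dist_start[of p a b] by (metis DiffD1 imageI)
qed

lemma open_tree_arc_borel [measurable]: "open_tree_arc a (b::'a::real_tree) \<in> sets borel"
  unfolding open_tree_arc_eq by simp

lemma tree_arc_subset_Un:
  fixes a b c :: "'a::real_tree"
  shows "tree_arc a b \<subseteq> tree_arc c a \<union> tree_arc c b"
proof
  fix x assume x: "x \<in> tree_arc a b"
  obtain m where m: "m \<in> tree_arc c a" "m \<in> tree_arc c b" "m \<in> tree_arc a b"
    by (rule tripod_center)
  have "x \<in> tree_arc a m \<or> x \<in> tree_arc b m"
    using x m(3) tree_arc_prefix[of m a b] tree_arc_prefix[of m b a]
    by (auto simp: tree_arc_commute[of b a]) (auto simp: mem_tree_arc_iff dist_commute)
  then show "x \<in> tree_arc c a \<union> tree_arc c b"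
    using m tree_arc_prefix[of m a c] tree_arc_prefix[of m b c]
    by (auto simp: tree_arc_commute[of a c] tree_arc_commute[of b c])
qed

text \<open>Up to one point, every arc consists of two differences of nested rooted arcs, which are
  disjoint by \<open>tree_arc_Int_meet\<close>. This carries measures and integrals over arbitrary
  arcs back to rooted ones.\<close>

lemma tree_arc_Diff_meet:
  fixes \<rho> a b :: "'a::real_tree"
  defines "m \<equiv> meet \<rho> a b"
  shows "tree_arc a b - {m} = (tree_arc \<rho> a - tree_arc \<rho> m) \<union> (tree_arc \<rho> b - tree_arc \<rho> m)"
proof -
  have m: "m \<in> tree_arc \<rho> a" "m \<in> tree_arc \<rho> b"
    unfolding m_def by (auto simp: meet_in_tree_arc)
  have mab: "m \<in> tree_arc a b"
    using m dist_meet[of \<rho> a b] dist_commute[of m a] unfolding m_def[symmetric] mem_tree_arc_iff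
    by argo
  have sub: "tree_arc \<rho> x - tree_arc \<rho> m \<subseteq> tree_arc x m - {m}" if "m \<in> tree_arc \<rho> x" for x
  proof
    fix q assume q: "q \<in> tree_arc \<rho> x - tree_arc \<rho> m"
    have "\<not> dist \<rho> q \<le> dist \<rho> m" using q unfolding tree_arc_prefix[OF that] by blast
    then have less: "dist \<rho> m < dist \<rho> q" by simp
    moreover have mx: "m \<in> tree_arc x \<rho>" and qx: "q \<in> tree_arc x \<rho>"
      using that q tree_arc_commute[of x \<rho>] by simp_all
    ultimately have "dist x q \<le> dist x m"
      using dist_commute[of q \<rho>] dist_commute[of m \<rho>] unfolding mem_tree_arc_iff by linarith
    then have "q \<in> tree_arc x m" using qx tree_arc_prefix[OF mx] by blast
    with less show "q \<in> tree_arc x m - {m}" by blast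
  qed
  show ?thesis
  proof (intro equalityI subsetI)
    fix x assume x: "x \<in> tree_arc a b - {m}"
    have "x \<notin> tree_arc \<rho> m"
    proof
      assume "x \<in> tree_arc \<rho> m"
      \<comment> \<open>From such an \<open>x\<close>, both \<open>a\<close> and \<open>b\<close>
        are reached only through \<open>m\<close>, so the route from \<open>a\<close> to
        \<open>b\<close> via \<open>x\<close> exceeds \<open>dist a b\<close> by twice
        \<open>dist x m\<close>.\<close>
      then have "dist x m = 0"
        using x m mab dist_triangle[of a \<rho> x] dist_triangle[of b \<rho> x] dist_commute[of a m]
          dist_commute[of b m] dist_commute[of \<rho> a] dist_commute[of \<rho> b] dist_commute[of \<rho> x]
          dist_commute[of x b] zero_le_dist[of x m]
        unfolding mem_tree_arc_iff Diff_iff by linarith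
      with x show False by simp
    qed
    then show "x \<in> (tree_arc \<rho> a - tree_arc \<rho> m) \<union> (tree_arc \<rho> b - tree_arc \<rho> m)"
      using x tree_arc_subset_Un by fastforce
  next
    fix x assume "x \<in> (tree_arc \<rho> a - tree_arc \<rho> m) \<union> (tree_arc \<rho> b - tree_arc \<rho> m)"
    then have "x \<in> tree_arc a m - {m} \<or> x \<in> tree_arc b m - {m}"
      using sub m by blast
    then show "x \<in> tree_arc a b - {m}"
      using mab tree_arc_prefix[of m a b] tree_arc_prefix[of m b a] by (auto simp: tree_arc_commute[of b a])
  qed
qed

text \<open>A point \<open>y n\<close> closer to \<open>a\<close> than \<open>x\<close> is must
  branch off the arc from the root to \<open>a\<close> beyond \<open>x\<close>. The tip
  \<open>a\<close> itself can be missed, for example if it is a leaf.\<close>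

lemma tree_arc_subset_UN_dense:
  fixes \<rho> a :: "'a::real_tree"
  assumes "closure (range y) = UNIV"
  shows "tree_arc \<rho> a - {a} \<subseteq> (\<Union>n::nat. tree_arc \<rho> (y n))"
proof
  fix x assume x: "x \<in> tree_arc \<rho> a - {a}"
  then obtain n where n: "dist (y n) a < dist x a"
    using assms closure_approachable[of a "range y"] by (metis DiffD2 UNIV_I imageE singletonI zero_less_dist_iff)
  obtain c where c: "c \<in> tree_arc \<rho> a" "c \<in> tree_arc \<rho> (y n)" "c \<in> tree_arc a (y n)"
    by (rule tripod_center)
  have "dist \<rho> x \<le> dist \<rho> c"
    using x c n zero_le_dist[of c "y n"] dist_commute[of a c] dist_commute[of a "y n"]
    unfolding mem_tree_arc_iff Diff_iff by linarith
  then have "x \<in> tree_arc \<rho> (y n)"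
    using x tree_arc_prefix[OF c(1)] tree_arc_prefix[OF c(2)] by auto
  then show "x \<in> (\<Union>n. tree_arc \<rho> (y n))" by auto
qed

lemma skeleton_subset_UN_dense:
  fixes \<rho> :: "'a::real_tree"
  assumes "closure (range y) = UNIV"
  shows "skeleton \<subseteq> (\<Union>n::nat. tree_arc \<rho> (y n))"
proof
  fix x :: 'a assume "x \<in> skeleton"
  then obtain a b where "x \<in> tree_arc a b - {a, b}"
    unfolding skeleton_def open_tree_arc_eq by auto
  then show "x \<in> (\<Union>n. tree_arc \<rho> (y n))"
    using tree_arc_subset_Un[of a b \<rho>] tree_arc_subset_UN_dense[OF assms, of \<rho>] by blast
qed

section \<open>Existence and uniqueness of the length measure\<close>

lemma sequence_dense_if_compact:
  assumes "compact (UNIV :: 'a::metric_space set)"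
  obtains y :: "nat \<Rightarrow> 'a::metric_space" where "closure (range y) = UNIV"
proof -
  have "\<exists>k. finite k \<and> (UNIV :: 'a set) \<subseteq> (\<Union>x\<in>k. ball x (1 / Suc n))" for n
    by (rule compactE_image[OF assms, of UNIV "\<lambda>x. ball x (1 / Suc n)"]) auto
  then obtain k where k: "\<And>n. finite (k n)" "\<And>n. (UNIV :: 'a set) \<subseteq> (\<Union>x\<in>k n. ball x (1 / Suc n))"
    by metis
  define D where "D = (\<Union>n. k n)"
  have "countable D" unfolding D_def using k(1) by (simp add: countable_finite)
  moreover have dense: "closure D = UNIV"
  proof (intro equalityI subset_UNIV subsetI)
    fix x
    show "x \<in> closure D"
      unfolding closure_approachable
    proof (intro allI impI)
      fix e :: real assume "e > 0"
      then obtain n where "1 / Suc n < e" using nat_approx_posE by blast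
      moreover obtain z where "z \<in> k n" "dist z x < 1 / Suc n" using subsetD[OF k(2)[of n] UNIV_I[of x]] by auto
      ultimately show "\<exists>z\<in>D. dist z x < e" unfolding D_def by (intro bexI[of _ z]) auto
    qed
  qed
  moreover have "D \<noteq> {}" using dense by auto
  ultimately show thesis using that range_from_nat_into by metis
qed

text \<open>Only open arcs have prescribed measure. Inside one, a point \<open>p\<close> separates
  two open arcs whose lengths already add up to the finite total, leaving nothing for
  \<open>p\<close>; points off the skeleton lie in a null set anyway.\<close>

lemma
  fixes M :: "'a::real_tree measure"
  assumes M: "is_length_measure M"
  shows emeasure_length_singleton: "emeasure M {p} = 0"
    and emeasure_length_tree_arc: "emeasure M (tree_arc a b) = ennreal (dist a b)"
proof -
  have sets [measurable_cong, simp]: "sets M = sets borel"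
    and arcs: "\<And>a b. emeasure M (open_tree_arc a b) = ennreal (dist a b)"
    and null: "- skeleton \<in> null_sets M"
    using M unfolding is_length_measure_def by auto
  show single: "emeasure M {p} = 0" for p
  proof (cases "p \<in> skeleton")
    case True
    then obtain a b where p: "p \<in> tree_arc a b" "p \<noteq> a" "p \<noteq> b"
      unfolding skeleton_def open_tree_arc_eq by auto
    have "tree_arc a p \<subseteq> tree_arc a b" "tree_arc p b \<subseteq> tree_arc a b"
      using p(1) tree_arc_prefix[of p a b] tree_arc_prefix[of p b a]
      by (auto simp: tree_arc_commute[of b])
    moreover have "b \<notin> tree_arc a p" "a \<notin> tree_arc p b"
      using p zero_less_dist_iff[of p b] zero_less_dist_iff[of p a] dist_commute[of a p]
        dist_commute[of b p] dist_commute[of b a]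
      unfolding mem_tree_arc_iff by linarith+
    ultimately have sub: "open_tree_arc a p \<union> {p} \<union> open_tree_arc p b \<subseteq> open_tree_arc a b"
      using p unfolding open_tree_arc_eq by blast
    have "tree_arc a p \<inter> tree_arc p b \<subseteq> {p}"
    proof
      fix q assume "q \<in> tree_arc a p \<inter> tree_arc p b"
      then have "dist p q = 0"
        using p(1) dist_triangle[of a b q] dist_commute[of p q] zero_le_dist[of p q]
        unfolding mem_tree_arc_iff Int_iff by linarith
      then show "q \<in> {p}" by simp
    qed
    then have "emeasure M (open_tree_arc a p) + emeasure M {p} + emeasure M (open_tree_arc p b)
        = emeasure M (open_tree_arc a p \<union> {p} \<union> open_tree_arc p b)"
      by (subst plus_emeasure, simp, simp, simp add: open_tree_arc_eq)
        (subst plus_emeasure, auto simp: open_tree_arc_eq)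
    also have "\<dots> \<le> emeasure M (open_tree_arc a b)"
      by (rule emeasure_mono[OF sub]) simp
    finally have "ennreal (dist a b) + emeasure M {p} \<le> ennreal (dist a b) + 0"
      using p(1) unfolding arcs mem_tree_arc_iff by (metis add.assoc add.commute add.right_neutral ennreal_plus zero_le_dist)
    then show ?thesis
      by (subst (asm) ennreal_add_left_cancel_le) auto
  next
    case False
    then have "{p} \<subseteq> - skeleton" by auto
    then show ?thesis using null by (metis emeasure_mono le_zero_eq null_setsD1 null_setsD2)
  qed
  have "{a, b} \<in> null_sets M"
    using null_sets.Un[of "{a}" M "{b}"] single by (auto simp: null_sets_def insert_commute)
  then have "emeasure M (open_tree_arc a b) = emeasure M (tree_arc a b)"
    unfolding open_tree_arc_eq by (rule emeasure_Diff_null_set) simp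
  then show "emeasure M (tree_arc a b) = ennreal (dist a b)" by (simp add: arcs)
qed

text \<open>The exceptional null set is a parameter because it varies: the complement of the
  skeleton for a length measure, a single endpoint for Lebesgue measure on one arc.\<close>

lemma emeasure_disjointed_arcs:
  fixes M :: "'a::real_tree measure" and I :: "nat \<Rightarrow> 'a set"
  assumes "sets M = sets borel" "\<And>n. I n \<in> sets borel" "A \<in> sets borel"
    and "A - (\<Union>n. I n) \<subseteq> N" "N \<in> null_sets M"
  shows "emeasure M A = (\<Sum>n. emeasure M (A \<inter> disjointed I n))"
proof -
  have D: "disjointed I n \<in> sets borel" for n
    using sets.range_disjointed_sets[of I borel] assms(2) by blast
  have "(\<Sum>n. emeasure M (A \<inter> disjointed I n)) = emeasure M (\<Union>n. A \<inter> disjointed I n)"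
  proof (rule suminf_emeasure)
    show "disjoint_family (\<lambda>n. A \<inter> disjointed I n)"
      using disjoint_family_disjointed[of I] unfolding disjoint_family_on_def by blast
  qed (use assms D in auto)
  also have "(\<Union>n. A \<inter> disjointed I n) = A - (A - (\<Union>n. I n))"
    using UN_disjointed_eq[of I] by blast
  also have "emeasure M \<dots> = emeasure M A"
    using assms null_sets_subset[OF assms(5)] by (intro emeasure_Diff_null_set) (auto simp: sets.countable_UN)
  finally show ?thesis ..
qed

lemma length_measure_unique:
  fixes M N :: "'a::real_tree measure" and y :: "nat \<Rightarrow> 'a"
  assumes dense: "closure (range y) = UNIV" and M: "is_length_measure M" and N: "is_length_measure N"
  shows "M = N"
proof (rule measure_eqI)
  have sets [simp]: "sets M = sets borel" "sets N = sets borel"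
    and null: "- skeleton \<in> null_sets M" "- skeleton \<in> null_sets N"
    using M N unfolding is_length_measure_def by auto
  then show "sets M = sets N" by simp
  fix A assume "A \<in> sets M"
  then have A: "A \<in> sets borel" by simp
  let ?I = "\<lambda>n. tree_arc (y 0) (y n)"
  have D: "disjointed ?I n \<in> sets borel" for n
    using sets.range_disjointed_sets[of ?I borel] by fastforce
  have null': "A - (\<Union>n. ?I n) \<subseteq> - skeleton"
    using skeleton_subset_UN_dense[OF dense, of "y 0"] by blast
  have "emeasure M (A \<inter> disjointed ?I n) = emeasure N (A \<inter> disjointed ?I n)" for n
  proof (rule measure_eq_on_tree_arc)
    show "A \<inter> disjointed ?I n \<subseteq> tree_arc (y 0) (y n)" using disjointed_subset[of ?I n] by blast
  qed (use A D in \<open>auto simp: emeasure_length_tree_arc[OF M] emeasure_length_tree_arc[OF N]\<close>)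
  then show "emeasure M A = emeasure N A"
    by (subst (1 2) emeasure_disjointed_arcs[where I = ?I, OF _ _ A null']) (auto simp: null)
qed

section \<open>Lebesgue measure on one arc, and gluing along arcs from a root\<close>

definition arc_lebesgue :: "'a::real_tree \<Rightarrow> 'a \<Rightarrow> 'a measure" where
  "arc_lebesgue a b = distr (restrict_space lborel {0..dist a b}) borel (geodesic a b)"

lemma sets_arc_lebesgue [simp, measurable_cong]: "sets (arc_lebesgue a b) = sets borel"
  by (simp add: arc_lebesgue_def)

lemma emeasure_arc_lebesgue:
  fixes a b :: "'a::real_tree"
  assumes "A \<in> sets borel"
  shows "emeasure (arc_lebesgue a b) A = emeasure lborel {t \<in> {0..dist a b}. geodesic a b t \<in> A}"
proof -
  have "geodesic a b \<in> borel_measurable (restrict_space borel {0..dist a b})"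
    by (intro borel_measurable_continuous_on_restrict continuous_on_geodesic)
  then have "geodesic a b \<in> borel_measurable (restrict_space lborel {0..dist a b})"
    by (simp add: measurable_cong_sets[OF sets_restrict_space_cong[OF sets_lborel] refl])
  then have "emeasure (arc_lebesgue a b) A
      = emeasure (restrict_space lborel {0..dist a b}) (geodesic a b -` A \<inter> {0..dist a b})"
    unfolding arc_lebesgue_def using assms by (simp add: emeasure_distr space_restrict_space)
  also have "\<dots> = emeasure lborel (geodesic a b -` A \<inter> {0..dist a b})"
    by (rule emeasure_restrict_space) auto
  also have "geodesic a b -` A \<inter> {0..dist a b} = {t \<in> {0..dist a b}. geodesic a b t \<in> A}" by auto
  finally show ?thesis .
qed

lemma emeasure_arc_lebesgue_prefix:
  fixes a b p :: "'a::real_tree"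
  assumes "p \<in> tree_arc a b"
  shows "emeasure (arc_lebesgue a b) (tree_arc a p) = ennreal (dist a p)"
proof -
  have "{t \<in> {0..dist a b}. geodesic a b t \<in> tree_arc a p} = {0..dist a p}"
    unfolding tree_arc_prefix[OF assms]
    using geodesic_in_tree_arc[of _ a b] dist_geodesic_start[of _ a b] dist_le_tree_arc[OF assms]
    by auto
  then show ?thesis by (simp add: emeasure_arc_lebesgue)
qed

lemma emeasure_arc_lebesgue_singleton:
  fixes a b p :: "'a::real_tree"
  shows "emeasure (arc_lebesgue a b) {p} = 0"
proof -
  have "{t \<in> {0..dist a b}. geodesic a b t \<in> {p}} \<subseteq> {dist a p}"
    using dist_geodesic_start[of _ a b] by auto
  then have "countable {t \<in> {0..dist a b}. geodesic a b t \<in> {p}}"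
    using countable_subset by (meson countable_insert countable_empty)
  then show ?thesis by (simp only: emeasure_arc_lebesgue[OF borel_singleton[OF sets.empty_sets]] emeasure_lborel_countable)
qed

text \<open>The set lies on the common part of the two arcs, which is the arc to the meet. Both
  measures give each initial piece of it its length, so they agree there. This is the compatibility
  that gluing relies on.\<close>

lemma arc_lebesgue_consistent:
  fixes a b c :: "'a::real_tree"
  assumes "A \<in> sets borel" "A \<subseteq> tree_arc a b" "A \<subseteq> tree_arc a c"
  shows "emeasure (arc_lebesgue a b) A = emeasure (arc_lebesgue a c) A"
proof (rule measure_eq_on_tree_arc)
  show "A \<subseteq> tree_arc a (meet a b c)"
    using assms tree_arc_Int_meet by blast
  show "emeasure (arc_lebesgue a b) (tree_arc a (meet a b c)) < \<infinity>"
    by (simp add: emeasure_arc_lebesgue_prefix meet_in_tree_arc)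
  fix p assume "p \<in> tree_arc a (meet a b c)"
  then have "p \<in> tree_arc a b" "p \<in> tree_arc a c"
    using tree_arc_Int_meet by blast+
  then show "emeasure (arc_lebesgue a b) (tree_arc a p) = emeasure (arc_lebesgue a c) (tree_arc a p)"
    by (simp add: emeasure_arc_lebesgue_prefix)
qed (use assms in auto)

lemma length_measure_exists:
  fixes y :: "nat \<Rightarrow> 'a::real_tree"
  assumes dense: "closure (range y) = UNIV"
  shows "\<exists>M :: 'a measure. is_length_measure M"
proof -
  define \<rho> where "\<rho> = y 0"
  define I where "I n = tree_arc \<rho> (y n)" for n
  define D where "D = disjointed I"
  \<comment> \<open>Each new arc contributes Lebesgue measure on the part not covered by the earlier ones.\<close>
  define \<mu> where "\<mu> A = (\<Sum>n. emeasure (arc_lebesgue \<rho> (y n)) (A \<inter> D n))" for A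
  define M where "M = measure_of UNIV (sets borel) \<mu>"
  have I [measurable, simp]: "I n \<in> sets borel" for n by (simp add: I_def)
  have D [measurable, simp]: "D n \<in> sets borel" for n
    using sets.range_disjointed_sets[of I borel] unfolding D_def by fastforce
  have D_sub: "D n \<subseteq> tree_arc \<rho> (y n)" for n
    using disjointed_subset[of I n] by (simp add: D_def I_def)
  have setsM [simp, measurable_cong]: "sets M = sets borel"
    using sets.sigma_sets_eq[of borel] by (simp add: M_def)
  have spaceM: "space M = UNIV" by (simp add: M_def)
  have M: "emeasure M A = \<mu> A" if "A \<in> sets borel" for A
    unfolding M_def
  proof (rule emeasure_measure_of_sigma)
    show "sigma_algebra UNIV (sets borel :: 'a set set)"
      using sets.sigma_algebra_axioms[of borel] by simp
    show "positive (sets borel) \<mu>" by (simp add: positive_def \<mu>_def)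
    show "countably_additive (sets borel) \<mu>"
    proof (rule countably_additiveI)
      fix A :: "nat \<Rightarrow> 'a set"
      assume A: "range A \<subseteq> sets borel" "disjoint_family A" "(\<Union>i. A i) \<in> sets borel"
      \<comment> \<open>The two sums are exchanged by reading the one over \<open>n\<close> as an
        integral against counting measure.\<close>
      have "(\<Sum>i. \<mu> (A i))
          = (\<integral>\<^sup>+n. (\<Sum>i. emeasure (arc_lebesgue \<rho> (y n)) (A i \<inter> D n)) \<partial>count_space UNIV)"
        by (subst nn_integral_suminf) (simp_all add: \<mu>_def nn_integral_count_space_nat)
      also have "\<dots> = (\<integral>\<^sup>+n. emeasure (arc_lebesgue \<rho> (y n)) ((\<Union>i. A i) \<inter> D n) \<partial>count_space UNIV)"
      proof (rule nn_integral_cong)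
        fix n
        have "(\<Sum>i. emeasure (arc_lebesgue \<rho> (y n)) (A i \<inter> D n))
            = emeasure (arc_lebesgue \<rho> (y n)) (\<Union>i. A i \<inter> D n)"
          using A by (intro suminf_emeasure) (auto simp: disjoint_family_on_def)
        then show "(\<Sum>i. emeasure (arc_lebesgue \<rho> (y n)) (A i \<inter> D n))
            = emeasure (arc_lebesgue \<rho> (y n)) ((\<Union>i. A i) \<inter> D n)" by simp
      qed
      finally show "(\<Sum>i. \<mu> (A i)) = \<mu> (\<Union>i. A i)"
        by (simp add: \<mu>_def nn_integral_count_space_nat)
    qed
  qed (rule that)
  \<comment> \<open>The endpoint \<open>z\<close> is arbitrary here, not one of the
    \<open>y n\<close>. The arcs to the \<open>y n\<close> cover its arc up to the null set
    \<open>{z}\<close>, and on each piece consistency allows replacing one arc by another.\<close>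
  have rooted: "emeasure M A = emeasure (arc_lebesgue \<rho> z) A"
    if "A \<in> sets borel" "A \<subseteq> tree_arc \<rho> z" for A z
  proof -
    have "emeasure (arc_lebesgue \<rho> z) A = (\<Sum>n. emeasure (arc_lebesgue \<rho> z) (A \<inter> D n))"
      unfolding D_def
    proof (rule emeasure_disjointed_arcs)
      show "A - (\<Union>n. I n) \<subseteq> {z}"
        using that(2) tree_arc_subset_UN_dense[OF dense, of \<rho> z] unfolding I_def by blast
    qed (use that in \<open>auto simp: null_sets_def emeasure_arc_lebesgue_singleton\<close>)
    also have "\<dots> = (\<Sum>n. emeasure (arc_lebesgue \<rho> (y n)) (A \<inter> D n))"
      by (intro suminf_cong arc_lebesgue_consistent) (use that D_sub in auto)
    finally show ?thesis using M[OF that(1)] by (simp add: \<mu>_def)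
  qed
  have single: "{p} \<in> null_sets M" for p
    using rooted[of "{p}" p] emeasure_arc_lebesgue_singleton by (auto simp: null_sets_def)
  have arc: "emeasure M (tree_arc \<rho> z) = ennreal (dist \<rho> z)" for z
    using rooted[of "tree_arc \<rho> z" z] emeasure_arc_lebesgue_prefix[of z \<rho> z] by simp
  have "emeasure M (open_tree_arc a b) = ennreal (dist a b)" for a b
  proof -
    define m where "m = meet \<rho> a b"
    have m: "m \<in> tree_arc \<rho> a" "m \<in> tree_arc \<rho> b"
      and Int: "tree_arc \<rho> a \<inter> tree_arc \<rho> b = tree_arc \<rho> m"
      unfolding m_def by (auto simp: meet_in_tree_arc tree_arc_Int_meet)
    have part: "emeasure M (tree_arc \<rho> x - tree_arc \<rho> m) = ennreal (dist \<rho> x - dist \<rho> m)"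
      if "m \<in> tree_arc \<rho> x" for x
    proof -
      have "tree_arc \<rho> m \<subseteq> tree_arc \<rho> x" unfolding tree_arc_prefix[OF that] by blast
      then show ?thesis by (subst emeasure_Diff) (auto simp: arc ennreal_minus)
    qed
    have "emeasure M (open_tree_arc a b) = emeasure M (open_tree_arc a b - {m})"
      by (rule emeasure_Diff_null_set[symmetric]) (simp_all add: single)
    also have "open_tree_arc a b - {m} = tree_arc a b - {m} - {a, b}"
      unfolding open_tree_arc_eq by blast
    also have "emeasure M \<dots> = emeasure M (tree_arc a b - {m})"
      using null_sets.Un[OF single[of a] single[of b]]
      by (intro emeasure_Diff_null_set) (auto simp: insert_commute)
    also have "tree_arc a b - {m} = (tree_arc \<rho> a - tree_arc \<rho> m) \<union> (tree_arc \<rho> b - tree_arc \<rho> m)"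
      unfolding m_def by (rule tree_arc_Diff_meet)
    also have "emeasure M \<dots> = emeasure M (tree_arc \<rho> a - tree_arc \<rho> m) + emeasure M (tree_arc \<rho> b - tree_arc \<rho> m)"
      by (rule plus_emeasure[symmetric]) (use Int in auto)
    also have "\<dots> = ennreal (dist a b)"
      using m dist_meet[of \<rho> a b] dist_le_tree_arc[OF m(1)] dist_le_tree_arc[OF m(2)]
      by (simp add: part m_def[symmetric] flip: ennreal_plus)
    finally show ?thesis .
  qed
  moreover have outside: "- (\<Union>n. I n) \<in> null_sets M"
  proof (rule null_setsI)
    have "- (\<Union>n. I n) \<inter> D n = {}" for n using disjointed_subset[of I n] unfolding D_def by blast
    then show "emeasure M (- (\<Union>n. I n)) = 0" by (subst M) (auto simp: \<mu>_def Compl_in_sets_lebesgue)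
  qed auto
  moreover have "- skeleton \<in> null_sets M"
  proof -
    \<comment> \<open>An arc can leave the skeleton only at its two ends, so only countably many
      points of the covering are lost.\<close>
    have sub: "(\<Union>n. I n) - skeleton \<subseteq> insert \<rho> (range y)"
      unfolding I_def skeleton_def open_tree_arc_eq by blast
    then have "countable ((\<Union>n. I n) - skeleton)"
      by (rule countable_subset) simp
    then have "(\<Union>x\<in>(\<Union>n. I n) - skeleton. {x}) \<in> null_sets M"
      by (rule null_sets_UN') (rule single)
    moreover have "- skeleton = - (\<Union>n. I n) \<union> (\<Union>x\<in>(\<Union>n. I n) - skeleton. {x})"
      using skeleton_subset_UN_dense[OF dense, of \<rho>] unfolding I_def by blast
    ultimately show ?thesis using null_sets.Un[OF outside] by metis
  qed
  moreover have "sigma_finite_measure M"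
  proof
    show "\<exists>A. countable A \<and> A \<subseteq> sets M \<and> \<Union>A = space M \<and> (\<forall>a\<in>A. emeasure M a \<noteq> \<infinity>)"
      using null_setsD1[OF outside]
      by (intro exI[of _ "insert (- (\<Union>n. I n)) (range I)"]) (auto simp: spaceM I_def arc)
  qed
  ultimately show ?thesis unfolding is_length_measure_def using setsM by blast
qed

lemma is_length_measure_length_measure:
  assumes "compact (UNIV :: 'a::real_tree set)"
  shows "is_length_measure (length_measure :: 'a::real_tree measure)"
proof -
  obtain y :: "nat \<Rightarrow> 'a" where y: "closure (range y) = UNIV"
    using sequence_dense_if_compact[OF assms] .
  show ?thesis
    unfolding length_measure_def
    using length_measure_exists[OF y] length_measure_unique[OF y] by (metis theI')
qed

section \<open>Gradients\<close>

lemma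
  assumes "compact (UNIV :: 'a::real_tree set)"
  shows sets_length_measure: "sets (length_measure :: 'a measure) = sets borel"
    and emeasure_tree_arc: "emeasure length_measure (tree_arc (a::'a) b) = ennreal (dist a b)"
    and AE_length_neq: "AE z in length_measure. z \<noteq> (a::'a)"
proof -
  note M = is_length_measure_length_measure[OF assms]
  show sets: "sets (length_measure :: 'a measure) = sets borel"
    using M unfolding is_length_measure_def by blast
  show "emeasure length_measure (tree_arc a b) = ennreal (dist a b)"
    by (rule emeasure_length_tree_arc[OF M])
  show "AE z in length_measure. z \<noteq> a"
    by (rule AE_I[of _ _ "{a}"]) (auto simp: emeasure_length_singleton[OF M] sets)
qed

lemma tree_arc_self: "tree_arc a a = {a :: 'a::real_tree}"
  by (auto simp: mem_tree_arc_iff dist_commute[of _ a])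

text \<open>The sign convention makes the contributions of the common stretch from the root to the
  meet cancel. Being a gradient thus means that \<open>f\<close> is, up to a constant, the integral
  of \<open>g\<close> from the root.\<close>

lemma tree_integral_eq_diff:
  fixes \<rho> :: "'a::real_tree"
  assumes cpt: "compact (UNIV :: 'a set)"
    and g: "\<And>x y :: 'a. set_integrable length_measure (tree_arc x y) g"
  shows "tree_integral \<rho> g x y = set_lebesgue_integral length_measure (tree_arc \<rho> y) g
           - set_lebesgue_integral length_measure (tree_arc \<rho> x) g"
proof -
  have split: "set_lebesgue_integral length_measure (tree_arc m y) g
      = set_lebesgue_integral length_measure (tree_arc \<rho> y) g
        - set_lebesgue_integral length_measure (tree_arc \<rho> m) g"
    if m: "m \<in> tree_arc \<rho> y" for m y
  proof -
    have "meet \<rho> m y = m"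
      unfolding meet_def using m by (intro branch_point_eqI) auto
    then have D: "tree_arc m y - {m} = tree_arc \<rho> y - tree_arc \<rho> m"
      using tree_arc_Diff_meet[of m y \<rho>] by simp
    have sub: "tree_arc \<rho> m \<subseteq> tree_arc \<rho> y" unfolding tree_arc_prefix[OF m] by blast
    have "set_lebesgue_integral length_measure (tree_arc m y) g
        = (LINT z|length_measure. indicator (tree_arc \<rho> y) z *\<^sub>R g z - indicator (tree_arc \<rho> m) z *\<^sub>R g z)"
      unfolding set_lebesgue_integral_def
    proof (rule integral_cong_AE)
      show "AE z in length_measure. indicator (tree_arc m y) z *\<^sub>R g z
          = indicator (tree_arc \<rho> y) z *\<^sub>R g z - indicator (tree_arc \<rho> m) z *\<^sub>R g z"
        using AE_length_neq[OF cpt, of m]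
      proof eventually_elim
        case (elim z)
        then have "z \<in> tree_arc m y \<longleftrightarrow> z \<in> tree_arc \<rho> y \<and> z \<notin> tree_arc \<rho> m" using D by blast
        then show ?case using sub by (auto simp: indicator_def)
      qed
    qed (use g in \<open>auto simp: set_integrable_def dest: borel_measurable_integrable\<close>)
    also have "\<dots> = set_lebesgue_integral length_measure (tree_arc \<rho> y) g
        - set_lebesgue_integral length_measure (tree_arc \<rho> m) g"
      using g unfolding set_lebesgue_integral_def set_integrable_def by (intro Bochner_Integration.integral_diff)
    finally show ?thesis .
  qed
  show ?thesis
    unfolding tree_integral_def using split[OF meet_in_tree_arc(1)[of \<rho> x y]]
      split[OF meet_in_tree_arc(2)[of \<rho> x y]] by linarith
qed

lemma has_gradient_iff:
  fixes \<rho> :: "'a::real_tree"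
  assumes cpt: "compact (UNIV :: 'a set)"
  shows "has_gradient \<rho> f g \<longleftrightarrow> g \<in> borel_measurable borel \<and>
           (\<forall>x y. set_integrable length_measure (tree_arc x y) g) \<and>
           (\<forall>x y. f y - f x = set_lebesgue_integral length_measure (tree_arc \<rho> y) g
              - set_lebesgue_integral length_measure (tree_arc \<rho> x) g)"
proof (cases "\<forall>x y :: 'a. set_integrable length_measure (tree_arc x y) g")
  case True
  then show ?thesis
    unfolding has_gradient_def using tree_integral_eq_diff[OF cpt, of g \<rho>] by simp
next
  case False
  then show ?thesis unfolding has_gradient_def by blast
qed

text \<open>The positive and negative parts of \<open>u\<close> are densities of two measures that
  agree on all rooted arcs, hence on all Borel subsets of such an arc. On the set where
  \<open>u\<close> is positive the second one vanishes, so the first does too; countably many arcs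
  suffice.\<close>

lemma AE_nonpos_if_arc_integrals_zero:
  fixes u :: "'a::real_tree \<Rightarrow> real" and \<rho> :: 'a
  assumes cpt: "compact (UNIV :: 'a set)"
    and u: "u \<in> borel_measurable borel"
    and int: "\<And>y. set_integrable length_measure (tree_arc \<rho> y) u"
    and zero: "\<And>y. set_lebesgue_integral length_measure (tree_arc \<rho> y) u = 0"
  shows "AE z in length_measure. u z \<le> 0"
proof -
  note M = is_length_measure_length_measure[OF cpt]
  have sets [simp, measurable_cong]: "sets (length_measure :: 'a measure) = sets borel"
    by (rule sets_length_measure[OF cpt])
  note u [measurable]
  obtain y :: "nat \<Rightarrow> 'a" where y: "closure (range y) = UNIV"
    using sequence_dense_if_compact[OF cpt] .
  \<comment> \<open>Since \<open>ennreal\<close> cuts negative values off at 0, \<open>N 1\<close>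
    has the positive part of \<open>u\<close> as density and \<open>N (-1)\<close> the negative
    part.\<close>
  define N where "N s = density length_measure (\<lambda>z. ennreal (s * u z))" for s
  have [simp]: "sets (N s) = sets borel" for s by (simp add: N_def)
  have N: "emeasure (N s) A = (\<integral>\<^sup>+z. ennreal (indicator A z * (s * u z)) \<partial>length_measure)"
    if "A \<in> sets borel" for s A
    unfolding N_def using that
    by (subst emeasure_density) (auto intro!: nn_integral_cong split: split_indicator)
  have fin: "emeasure (N s) (tree_arc \<rho> p) < \<infinity>" if "s = 1 \<or> s = - 1" for s p
    using int[of p] that by (auto simp: N set_integrable_def real_integrable_def less_top)
  have eq: "emeasure (N 1) (tree_arc \<rho> p) = emeasure (N (-1)) (tree_arc \<rho> p)" for p
  proof -
    have "enn2real (emeasure (N 1) (tree_arc \<rho> p)) = enn2real (emeasure (N (-1)) (tree_arc \<rho> p))"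
      using zero[of p] int[of p] by (simp add: N set_lebesgue_integral_def set_integrable_def real_lebesgue_integral_def)
    then show ?thesis using fin[of 1 p] fin[of "-1" p] by (metis ennreal_enn2real infinity_ennreal_def)
  qed
  have arc: "AE z in length_measure. z \<in> tree_arc \<rho> p \<longrightarrow> u z \<le> 0" for p
  proof -
    define A where "A = {z \<in> space borel. 0 < u z} \<inter> tree_arc \<rho> p"
    have A: "A \<in> sets borel" unfolding A_def by measurable
    have "emeasure (N 1) A = emeasure (N (-1)) A"
      by (rule measure_eq_on_tree_arc[of _ _ \<rho> p]) (use A fin eq in \<open>auto simp: A_def\<close>)
    also have "\<dots> = (\<integral>\<^sup>+z. 0 \<partial>(length_measure :: 'a measure))"
      unfolding N[OF A] by (intro nn_integral_cong) (auto simp: A_def ennreal_neg split: split_indicator)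
    finally have "(\<integral>\<^sup>+z. ennreal (indicator A z * u z) \<partial>length_measure) = 0"
      by (simp add: N[OF A])
    then have "AE z in length_measure. ennreal (indicator A z * u z) = 0"
      using A by (subst (asm) nn_integral_0_iff_AE) auto
    then show ?thesis
    proof eventually_elim
      case (elim z)
      then show ?case by (cases "0 < u z") (auto simp: A_def)
    qed
  qed
  have "AE z in length_measure. z \<notin> - (skeleton :: 'a set)"
    using M unfolding is_length_measure_def by (intro AE_not_in) auto
  moreover have "AE z in length_measure. \<forall>n. z \<in> tree_arc \<rho> (y n) \<longrightarrow> u z \<le> 0"
    unfolding AE_all_countable using arc by blast
  ultimately show ?thesis
    by eventually_elim (use skeleton_subset_UN_dense[OF y, of \<rho>] in blast)
qed

lemma has_gradient_unique:
  fixes \<rho> :: "'a::real_tree"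
  assumes cpt: "compact (UNIV :: 'a set)"
    and g: "has_gradient \<rho> f g" and h: "has_gradient \<rho> f h"
  shows "AE z in length_measure. g z = h z"
proof -
  note iff = has_gradient_iff[OF cpt]
  have "AE z in length_measure. k z - l z \<le> 0"
    if k: "has_gradient \<rho> f k" and l: "has_gradient \<rho> f l" for k l
  proof (rule AE_nonpos_if_arc_integrals_zero[OF cpt])
    have [simp]: "set_lebesgue_integral length_measure (tree_arc \<rho> \<rho>) q = 0" for q :: "'a \<Rightarrow> real"
      unfolding set_lebesgue_integral_def tree_arc_self
      by (rule integral_eq_zero_AE, rule eventually_mono[OF AE_length_neq[OF cpt, of \<rho>]]) simp
    show "(\<lambda>z. k z - l z) \<in> borel_measurable borel" using k l by (auto simp: iff)
    fix y
    have grad: "f y - f \<rho> = set_lebesgue_integral length_measure (tree_arc \<rho> y) q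
        \<and> set_integrable length_measure (tree_arc \<rho> y) q" if "has_gradient \<rho> f q" for q
    proof -
      have "f y - f \<rho> = set_lebesgue_integral length_measure (tree_arc \<rho> y) q
          - set_lebesgue_integral length_measure (tree_arc \<rho> \<rho>) q"
        "set_integrable length_measure (tree_arc \<rho> y) q"
        using that unfolding iff by blast+
      then show ?thesis by simp
    qed
    from grad[OF k] grad[OF l]
    show "set_integrable length_measure (tree_arc \<rho> y) (\<lambda>z. k z - l z)"
      "set_lebesgue_integral length_measure (tree_arc \<rho> y) (\<lambda>z. k z - l z) = 0"
      by (auto simp: set_integral_diff)
  qed
  from this[OF g h] this[OF h g] show ?thesis by eventually_elim auto
qed

text \<open>The difference of the two indicators is \<open>\<plusminus>1\<close> on \<open>tree_arc b x\<close> and almost everywhere \<open>0\<close>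
  elsewhere; the sign makes its pairing with a gradient of \<open>f\<close> equal to \<open>f x - f b\<close>.\<close>

definition signed_arc :: "'a::real_tree \<Rightarrow> 'a \<Rightarrow> 'a \<Rightarrow> 'a \<Rightarrow> real" where
  "signed_arc \<rho> b x z = indicator (tree_arc \<rho> x) z - indicator (tree_arc \<rho> b) z"

lemma integral_signed_arc:
  fixes \<rho> b x :: "'a::real_tree"
  assumes g: "\<And>x y :: 'a. set_integrable length_measure (tree_arc x y) g"
  shows "integrable length_measure (\<lambda>z. g z * signed_arc \<rho> b x z)"
    and "(LINT z|length_measure. g z * signed_arc \<rho> b x z)
           = set_lebesgue_integral length_measure (tree_arc \<rho> x) g
             - set_lebesgue_integral length_measure (tree_arc \<rho> b) g"
proof -
  have eq: "(\<lambda>z. g z * signed_arc \<rho> b x z)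
      = (\<lambda>z. indicator (tree_arc \<rho> x) z *\<^sub>R g z - indicator (tree_arc \<rho> b) z *\<^sub>R g z)"
    by (auto simp: signed_arc_def algebra_simps)
  show "integrable length_measure (\<lambda>z. g z * signed_arc \<rho> b x z)"
    unfolding eq using g unfolding set_integrable_def by (intro Bochner_Integration.integrable_diff)
  show "(LINT z|length_measure. g z * signed_arc \<rho> b x z)
      = set_lebesgue_integral length_measure (tree_arc \<rho> x) g
        - set_lebesgue_integral length_measure (tree_arc \<rho> b) g"
    unfolding eq set_lebesgue_integral_def
    using g unfolding set_integrable_def by (intro Bochner_Integration.integral_diff)
qed

text \<open>The square of a difference of indicators is their sum minus twice the indicator of the
  intersection, here the arc to the meet; \<open>dist_meet\<close> then yields exactly
  \<open>dist b x\<close>.\<close>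

lemma integral_signed_arc_square:
  fixes \<rho> b x :: "'a::real_tree"
  assumes cpt: "compact (UNIV :: 'a set)"
  shows "integrable length_measure (\<lambda>z. (signed_arc \<rho> b x z)\<^sup>2)"
    and "(LINT z|length_measure. (signed_arc \<rho> b x z)\<^sup>2) = dist b x"
proof -
  have [simp, measurable_cong]: "sets (length_measure :: 'a measure) = sets borel"
    by (rule sets_length_measure[OF cpt])
  let ?i = "\<lambda>p z. indicator (tree_arc \<rho> p) z :: real"
  have eq: "(\<lambda>z. (signed_arc \<rho> b x z)\<^sup>2) = (\<lambda>z. ?i x z + ?i b z - 2 * ?i (meet \<rho> b x) z)"
    using tree_arc_Int_meet[of \<rho> b x] by (auto simp: signed_arc_def fun_eq_iff split: split_indicator)
  have int: "integrable length_measure (?i p)" for p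
    by (rule integrable_real_indicator) (simp_all add: emeasure_tree_arc[OF cpt])
  have val: "measure length_measure (tree_arc \<rho> p) = dist \<rho> p" for p
    by (simp add: measure_def emeasure_tree_arc[OF cpt])
  show "integrable length_measure (\<lambda>z. (signed_arc \<rho> b x z)\<^sup>2)"
    unfolding eq using int by simp
  show "(LINT z|length_measure. (signed_arc \<rho> b x z)\<^sup>2) = dist b x"
    unfolding eq using int by (simp add: val dist_meet field_simps)
qed

lemma gradient_Cauchy_Schwarz:
  fixes \<rho> b x :: "'a::real_tree"
  assumes cpt: "compact (UNIV :: 'a set)"
    and f: "has_gradient \<rho> f g" and g: "integrable length_measure (\<lambda>z. (g z)\<^sup>2)"
  shows "(f x - f b)\<^sup>2 \<le> dist b x * (LINT z|length_measure. (g z)\<^sup>2)"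
proof (cases "b = x")
  case False
  define w where "w = signed_arc \<rho> b x"
  define P where "P = (LINT z|length_measure. g z * w z)"
  define E where "E = (LINT z|length_measure. (g z)\<^sup>2)"
  define D where "D = dist b x"
  have "D > 0" using False by (simp add: D_def)
  have arcs: "\<And>x y. set_integrable length_measure (tree_arc x y) g" and P: "f x - f b = P"
    using f integral_signed_arc(2)[of g \<rho> b x] by (auto simp: has_gradient_iff[OF cpt] P_def w_def)
  have gw: "integrable length_measure (\<lambda>z. g z * w z)"
    unfolding w_def by (rule integral_signed_arc(1)[OF arcs])
  note w2 = integral_signed_arc_square[OF cpt, of \<rho> b x, folded w_def D_def]
  \<comment> \<open>\<open>D\<close> is the squared norm of \<open>w\<close> and \<open>P\<close>
    its pairing with \<open>g\<close>, so \<open>D * g - P * w\<close> is \<open>D\<close> times the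
    part of \<open>g\<close> orthogonal to \<open>w\<close>.\<close>
  have "0 \<le> (LINT z|length_measure. (D * g z - P * w z)\<^sup>2)" by simp
  also have "\<dots> = (LINT z|length_measure. D\<^sup>2 * (g z)\<^sup>2 - 2 * D * P * (g z * w z) + P\<^sup>2 * (w z)\<^sup>2)"
    by (intro Bochner_Integration.integral_cong) (auto simp: power2_eq_square algebra_simps)
  also have "\<dots> = D\<^sup>2 * E - 2 * D * P * P + P\<^sup>2 * D"
    using g gw w2 by (simp add: E_def P_def)
  also have "\<dots> = D * (D * E - P\<^sup>2)" by (simp add: power2_eq_square algebra_simps)
  finally show ?thesis
    using \<open>D > 0\<close> unfolding P E_def[symmetric] D_def[symmetric] by (simp add: zero_le_mult_iff)
qed simp

text \<open>By almost-everywhere uniqueness, any explicit gradient can replace the one chosen by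
  \<open>SOME\<close>.\<close>

lemma form_eq_if_has_gradient:
  fixes \<rho> :: "'a::real_tree"
  assumes cpt: "compact (UNIV :: 'a set)" and f: "has_gradient \<rho> f g"
  shows "form \<rho> f f = 1/2 * (LINT z|length_measure. (g z)\<^sup>2)"
    and "has_gradient \<rho> f (gradient \<rho> f)"
    and "square_integrable length_measure (gradient \<rho> f) \<longleftrightarrow> integrable length_measure (\<lambda>z. (g z)\<^sup>2)"
proof -
  show grad: "has_gradient \<rho> f (gradient \<rho> f)"
    unfolding gradient_def by (rule someI[of "has_gradient \<rho> f", OF f])
  have [simp, measurable_cong]: "sets (length_measure :: 'a measure) = sets borel"
    by (rule sets_length_measure[OF cpt])
  have [measurable]: "g \<in> borel_measurable borel" "gradient \<rho> f \<in> borel_measurable borel"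
    using f grad by (auto simp: has_gradient_def)
  have ae: "AE z in length_measure. gradient \<rho> f z = g z"
    by (rule has_gradient_unique[OF cpt grad f])
  show "form \<rho> f f = 1/2 * (LINT z|length_measure. (g z)\<^sup>2)"
    unfolding form_def using ae
    by (intro arg_cong[of _ _ "\<lambda>x. 1/2 * x"] integral_cong_AE) (auto simp: power2_eq_square)
  have "integrable length_measure (\<lambda>z. (gradient \<rho> f z)\<^sup>2) \<longleftrightarrow> integrable length_measure (\<lambda>z. (g z)\<^sup>2)"
    using ae by (intro integrable_cong_AE) auto
  then show "square_integrable length_measure (gradient \<rho> f) \<longleftrightarrow> integrable length_measure (\<lambda>z. (g z)\<^sup>2)"
    by (simp add: square_integrable_def)
qed

section \<open>Lipschitz functions and the test function for the upper bound\<close>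

lemma locally_abs_continuous_if_lipschitz:
  fixes f :: "'a::real_tree \<Rightarrow> real"
  assumes "L-lipschitz_on UNIV f"
  shows "locally_abs_continuous f"
  unfolding locally_abs_continuous_def
proof (intro conjI allI impI ballI)
  show "continuous_on UNIV f" using assms by (rule lipschitz_on_continuous_on)
  fix \<epsilon> :: real and S assume "\<epsilon> > 0"
  have L: "L \<ge> 0" "\<And>x y. \<bar>f x - f y\<bar> \<le> L * dist x y"
    using assms unfolding lipschitz_on_def by (auto simp: dist_real_def)
  show "\<exists>\<delta>>0. \<forall>n::nat. \<forall>x y. disjoint_family_on (\<lambda>i. tree_arc (x i) (y i)) {..<n} \<longrightarrow>
      (\<forall>i<n. tree_arc (x i) (y i) \<subseteq> S) \<longrightarrow> (\<Sum>i<n. dist (x i) (y i)) < \<delta> \<longrightarrow>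
      (\<Sum>i<n. \<bar>f (x i) - f (y i)\<bar>) < \<epsilon>"
  \<comment> \<open>\<open>L + 1\<close> instead of \<open>L\<close> keeps the denominator positive
    when \<open>L = 0\<close>.\<close>
  proof (intro exI[of _ "\<epsilon> / (L + 1)"] conjI allI impI)
    fix n :: nat and x y :: "nat \<Rightarrow> 'a"
    assume less: "(\<Sum>i<n. dist (x i) (y i)) < \<epsilon> / (L + 1)"
    have "(\<Sum>i<n. \<bar>f (x i) - f (y i)\<bar>) \<le> (\<Sum>i<n. (L + 1) * dist (x i) (y i))"
      using L(2) by (intro sum_mono) (smt (verit) mult_right_mono zero_le_dist)
    also have "\<dots> < \<epsilon>"
      using less L(1) unfolding sum_distrib_left[symmetric] by (simp add: pos_less_divide_eq mult.commute)
    finally show "(\<Sum>i<n. \<bar>f (x i) - f (y i)\<bar>) < \<epsilon>" .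
  qed (use \<open>\<epsilon> > 0\<close> L(1) in auto)
qed

text \<open>As a function of \<open>y\<close> this is the distance from \<open>b\<close> to the branch point of \<open>y\<close> on \<open>tree_arc b x\<close>,
  the extremal function for the capacity between \<open>b\<close> and \<open>x\<close>.\<close>

definition gromov_product :: "'a::metric_space \<Rightarrow> 'a \<Rightarrow> 'a \<Rightarrow> real" where
  "gromov_product b x y = (dist b x + dist b y - dist x y) / 2"

lemma gromov_product_lipschitz: "1-lipschitz_on UNIV (gromov_product b x)"
proof (rule lipschitz_onI)
  fix y z
  show "dist (gromov_product b x y) (gromov_product b x z) \<le> 1 * dist y z"
    using dist_triangle[of b y z] dist_triangle[of b z y] dist_triangle[of x y z] dist_triangle[of x z y]
    by (simp add: gromov_product_def dist_real_def dist_commute[of z y] abs_le_iff field_simps)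
qed simp

text \<open>Integrating \<open>signed_arc\<close> from the root to \<open>y\<close> gives the
  difference of two Gromov products at the root. In it \<open>dist \<rho> y\<close> cancels, and
  what remains differs from \<open>gromov_product b x y\<close> by a constant in
  \<open>y\<close>.\<close>

lemma has_gradient_gromov_product:
  fixes \<rho> b x :: "'a::real_tree"
  assumes cpt: "compact (UNIV :: 'a set)"
  shows "has_gradient \<rho> (\<lambda>y. c * gromov_product b x y) (\<lambda>z. c * signed_arc \<rho> b x z)"
  unfolding has_gradient_iff[OF cpt]
proof (intro conjI allI)
  have [simp, measurable_cong]: "sets (length_measure :: 'a measure) = sets borel"
    by (rule sets_length_measure[OF cpt])
  show meas [measurable]: "(\<lambda>z. c * signed_arc \<rho> b x z) \<in> borel_measurable borel"
    unfolding signed_arc_def by measurable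
  have ind: "integrable length_measure (indicator (tree_arc p q) :: 'a \<Rightarrow> real)" for p q
    by (rule integrable_real_indicator) (simp_all add: emeasure_tree_arc[OF cpt])
  show "set_integrable length_measure (tree_arc p q) (\<lambda>z. c * signed_arc \<rho> b x z)" for p q
    unfolding set_integrable_def
  proof (rule Bochner_Integration.integrable_bound)
    show "integrable length_measure (\<lambda>z. \<bar>c\<bar> * indicator (tree_arc p q) z)" using ind by simp
  qed (auto simp: signed_arc_def abs_mult split: split_indicator)
  have G: "set_lebesgue_integral length_measure (tree_arc \<rho> y) (\<lambda>z. c * signed_arc \<rho> b x z)
      = c * (dist \<rho> (meet \<rho> x y) - dist \<rho> (meet \<rho> b y))" for y
  proof -
    have "set_lebesgue_integral length_measure (tree_arc \<rho> y) (\<lambda>z. c * signed_arc \<rho> b x z)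
        = (LINT z|length_measure. c * (indicator (tree_arc \<rho> (meet \<rho> x y)) z
            - indicator (tree_arc \<rho> (meet \<rho> b y)) z))"
      unfolding set_lebesgue_integral_def tree_arc_Int_meet[symmetric]
      by (intro Bochner_Integration.integral_cong) (auto simp: signed_arc_def split: split_indicator)
    then show ?thesis using ind by (simp add: measure_def emeasure_tree_arc[OF cpt])
  qed
  show "c * gromov_product b x q - c * gromov_product b x p
      = set_lebesgue_integral length_measure (tree_arc \<rho> q) (\<lambda>z. c * signed_arc \<rho> b x z)
        - set_lebesgue_integral length_measure (tree_arc \<rho> p) (\<lambda>z. c * signed_arc \<rho> b x z)" for p q
    unfolding G dist_meet gromov_product_def by (simp add: field_simps)
qed

section \<open>Bounds on the principal eigenvalue\<close>

lemma emeasure_UNIV_finite_if_radon: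
  assumes "compact (UNIV :: 'a::metric_space set)" "radon_full_support (\<nu> :: 'a measure)"
  shows "emeasure \<nu> UNIV < \<infinity>"
  using assms unfolding radon_full_support_def by blast

lemma gromov_product_in_killed_domain:
  fixes \<nu> :: "'a::real_tree measure" and \<rho> b x :: 'a
  assumes cpt: "compact (UNIV :: 'a set)" and \<nu>: "radon_full_support \<nu>"
  shows "(\<lambda>y. c * gromov_product b x y) \<in> killed_domain \<rho> \<nu> {b}"
    and "integrable \<nu> (\<lambda>y. (gromov_product b x y)\<^sup>2)"
proof -
  let ?f = "\<lambda>y. c * gromov_product b x y"
  have sets [simp, measurable_cong]: "sets \<nu> = sets borel"
    using \<nu> by (simp add: radon_full_support_def)
  have cont: "continuous_on UNIV (gromov_product b x)"
    using gromov_product_lipschitz by (rule lipschitz_on_continuous_on)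
  then have [measurable]: "gromov_product b x \<in> borel_measurable borel"
    by (rule borel_measurable_continuous_onI)
  have "finite_measure \<nu>"
    using emeasure_UNIV_finite_if_radon[OF cpt \<nu>] sets_eq_imp_space_eq[OF sets]
    by (intro finite_measureI) simp
  moreover obtain B where B: "\<And>y. \<bar>gromov_product b x y\<bar> \<le> B"
    using compact_imp_bounded[OF compact_continuous_image[OF cont cpt]] by (auto simp: bounded_iff)
  moreover have "norm ((gromov_product b x y)\<^sup>2) \<le> B\<^sup>2" for y
    using power_mono[OF B[of y] abs_ge_zero, of 2] by simp
  ultimately show int: "integrable \<nu> (\<lambda>y. (gromov_product b x y)\<^sup>2)"
    by (intro finite_measure.integrable_const_bound[where B = "B\<^sup>2"]) auto
  have "square_integrable \<nu> ?f"
    using int unfolding square_integrable_def power_mult_distrib by simp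
  moreover have "vanishing_at_infinity ?f"
    unfolding vanishing_at_infinity_def using cont cpt by (auto intro!: continuous_intros exI[of _ UNIV])
  moreover have "locally_abs_continuous ?f"
  proof (rule locally_abs_continuous_if_lipschitz)
    show "\<bar>c\<bar>-lipschitz_on UNIV ?f"
      using lipschitz_on_cmult_real[OF gromov_product_lipschitz[of b x], of c] by simp
  qed
  moreover note grad = has_gradient_gromov_product[OF cpt, of \<rho> c b x]
  have "square_integrable length_measure (gradient \<rho> ?f)"
    unfolding form_eq_if_has_gradient(3)[OF cpt grad] power_mult_distrib
    using integral_signed_arc_square(1)[OF cpt, of \<rho> b x] by simp
  ultimately show "?f \<in> killed_domain \<rho> \<nu> {b}"
    using form_eq_if_has_gradient(2)[OF cpt grad]
    by (simp add: killed_domain_def form_domain_def finite_energy_def gromov_product_def dist_commute)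
qed

lemma principal_eigenvalue_lower_bound:
  fixes \<nu> :: "'a::real_tree measure" and \<rho> b :: 'a
  assumes cpt: "compact (UNIV :: 'a set)" and \<nu>: "radon_full_support \<nu>"
  shows "1 / (2 * ennreal (diameter (UNIV :: 'a set)) * emeasure \<nu> UNIV)
           \<le> principal_eigenvalue \<rho> \<nu> {b}"
  unfolding principal_eigenvalue_def
proof (rule Inf_greatest, clarify)
  fix f e
  assume f: "f \<in> extended_domain \<rho> \<nu> {b}" and e: "has_energy \<rho> \<nu> {b} f e"
    and norm: "(\<integral>\<^sup>+x. e2ennreal ((f x)\<^sup>2) \<partial>\<nu>) = 1"
  have spaceN: "space \<nu> = UNIV"
    using \<nu> sets_eq_imp_space_eq[of \<nu> borel] unfolding radon_full_support_def by simp
  define d where "d = diameter (UNIV :: 'a set)"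
  have dist_le: "dist x y \<le> d" for x y :: 'a
    unfolding d_def using diameter_bounded_bound[OF compact_imp_bounded[OF cpt]] by simp
  have "d \<ge> 0" using dist_le[of b b] by simp
  obtain F where F: "\<And>n. F n \<in> killed_domain \<rho> \<nu> {b}"
    and lim: "AE x in \<nu>. (\<lambda>n. ereal (F n x)) \<longlonglongrightarrow> f x"
    and energy: "(\<lambda>n. form \<rho> (F n) (F n)) \<longlonglongrightarrow> e"
    using e unfolding has_energy_def approximating_def by blast
  \<comment> \<open>The estimate is made for the approximants, since \<open>f\<close> is only their
    almost-everywhere limit; both sides pass to the limit below.\<close>
  have form: "0 \<le> form \<rho> (F n) (F n) \<and> (F n x)\<^sup>2 \<le> 2 * d * form \<rho> (F n) (F n)" for n x
  proof -
    have Fn: "has_gradient \<rho> (F n) (gradient \<rho> (F n))"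
      "square_integrable length_measure (gradient \<rho> (F n))" "F n b = 0"
      using F[of n] by (auto simp: killed_domain_def form_domain_def finite_energy_def)
    let ?E = "LINT z|length_measure. (gradient \<rho> (F n) z)\<^sup>2"
    have "(F n x - F n b)\<^sup>2 \<le> dist b x * ?E"
      using Fn by (intro gradient_Cauchy_Schwarz[OF cpt]) (auto simp: square_integrable_def)
    also have "\<dots> \<le> d * ?E" by (intro mult_right_mono dist_le) simp
    finally show ?thesis
      by (simp add: Fn(3) form_eq_if_has_gradient(1)[OF cpt Fn(1)])
  qed
  then have "e \<ge> 0" by (intro LIMSEQ_le_const[OF energy]) auto
  have "AE x in \<nu>. e2ennreal ((f x)\<^sup>2) \<le> ennreal (2 * d * e)"
  proof -
    have "AE x in \<nu>. \<bar>f x\<bar> \<noteq> \<infinity>" using f unfolding extended_domain_def by blast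
    with lim show ?thesis
    proof eventually_elim
      case (elim x)
      then obtain r where r: "f x = ereal r" by (cases "f x") auto
      with elim have "(\<lambda>n. F n x) \<longlonglongrightarrow> r" by simp
      then have "r\<^sup>2 \<le> 2 * d * e"
        using form by (intro LIMSEQ_le[OF tendsto_power tendsto_mult_left[OF energy]]) auto
      then show ?case by (simp add: r ennreal_leI)
    qed
  qed
  then have "1 \<le> (\<integral>\<^sup>+x. ennreal (2 * d * e) \<partial>\<nu>)"
    unfolding norm[symmetric] by (rule nn_integral_mono_AE)
  also have "\<dots> = ennreal e * (2 * ennreal d * emeasure \<nu> UNIV)"
    using \<open>d \<ge> 0\<close> \<open>e \<ge> 0\<close> by (simp add: spaceN ennreal_mult mult_ac)
  finally have le: "1 \<le> ennreal e * (2 * ennreal d * emeasure \<nu> UNIV)" .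
  define c where "c = 2 * ennreal d * emeasure \<nu> UNIV"
  \<comment> \<open>The inequality itself excludes \<open>c = 0\<close>: a tree of diameter 0 has no
    admissible \<open>f\<close>. Finiteness of \<open>\<nu>\<close> excludes \<open>top\<close>, so
    division by \<open>c\<close> is safe.\<close>
  have "c \<noteq> 0" using le by (auto simp: c_def[symmetric])
  moreover have "c \<noteq> top"
    using emeasure_UNIV_finite_if_radon[OF cpt \<nu>]
    unfolding c_def by (auto simp: ennreal_mult_eq_top_iff)
  ultimately have "1 / c \<le> ennreal e"
    using divide_right_mono_ennreal[OF le, of c] by (simp add: c_def[symmetric] mult_divide_eq_ennreal)
  then show "1 / (2 * ennreal (diameter (UNIV :: 'a set)) * emeasure \<nu> UNIV) \<le> ennreal e"
    by (simp add: c_def d_def)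
qed

text \<open>This bounds the Rayleigh quotient of \<open>h\<close>, scaled to norm 1. The factor 2
  stands on the left so that the infimum over \<open>x\<close> can be taken before halving. If the
  mass behind \<open>x\<close> is 0, the right-hand side is infinite.\<close>

lemma principal_eigenvalue_upper_bound:
  fixes \<nu> :: "'a::real_tree measure" and \<rho> b x :: 'a
  assumes cpt: "compact (UNIV :: 'a set)" and \<nu>: "radon_full_support \<nu>" and "x \<noteq> b"
  shows "2 * principal_eigenvalue \<rho> \<nu> {b}
           \<le> inverse (emeasure \<nu> {y. x \<in> tree_arc y b} * ennreal (dist x b))"
proof (cases "emeasure \<nu> {y. x \<in> tree_arc y b} = 0")
  case False
  define A where "A = {y. x \<in> tree_arc y b}"
  define h where "h = gromov_product b x"
  define N where "N = (LINT y|\<nu>. (h y)\<^sup>2)"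
  define a where "a = measure \<nu> A"
  define d where "d = dist x b"
  have "d > 0" using \<open>x \<noteq> b\<close> by (simp add: d_def)
  have sets [simp, measurable_cong]: "sets \<nu> = sets borel"
    using \<nu> by (simp add: radon_full_support_def)
  \<comment> \<open>A nonzero value of \<open>emeasure\<close> already certifies
    measurability.\<close>
  have A: "A \<in> sets \<nu>" using False emeasure_notin_sets unfolding A_def by blast
  have [measurable]: "h \<in> borel_measurable borel"
    unfolding h_def by (intro borel_measurable_continuous_onI lipschitz_on_continuous_on[OF gromov_product_lipschitz])
  have "emeasure \<nu> A \<le> emeasure \<nu> UNIV" by (rule emeasure_mono) simp_all
  then have fin: "emeasure \<nu> A < \<infinity>"
    using emeasure_UNIV_finite_if_radon[OF cpt \<nu>] by (rule le_less_trans)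
  then have a: "emeasure \<nu> A = ennreal a" unfolding a_def by (intro emeasure_eq_ennreal_measure) auto
  then have "a > 0" using False by (simp add: A_def[symmetric] ennreal_eq_0_iff not_le)
  note int = gromov_product_in_killed_domain(2)[OF cpt \<nu>, of b x, folded h_def]
  have hA: "h y = d" if "y \<in> A" for y
    using that by (simp add: A_def h_def d_def gromov_product_def mem_tree_arc_iff dist_commute)
  have "d\<^sup>2 * a = (LINT y|\<nu>. d\<^sup>2 * indicator A y)"
    using A by (simp add: a_def)
  also have "\<dots> \<le> N"
    unfolding N_def using A fin int
    by (intro integral_mono integrable_mult_right integrable_real_indicator)
      (auto simp: hA split: split_indicator)
  finally have N: "d\<^sup>2 * a \<le> N" .
  then have "N > 0" using \<open>a > 0\<close> \<open>d > 0\<close> by (meson less_le_trans mult_pos_pos zero_less_power)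
  define c where "c = 1 / sqrt N"
  have c2: "c\<^sup>2 = 1 / N" using \<open>N > 0\<close> by (simp add: c_def power_divide)
  define f where "f y = ereal (c * h y)" for y
  define e where "e = d / (2 * N)"
  have "form \<rho> (\<lambda>y. c * h y) (\<lambda>y. c * h y) = e"
    using form_eq_if_has_gradient(1)[OF cpt has_gradient_gromov_product[OF cpt, of \<rho> c b x]]
      integral_signed_arc_square[OF cpt, of \<rho> b x] \<open>N > 0\<close>
    by (simp add: h_def power_mult_distrib c2 e_def d_def dist_commute)
  \<comment> \<open>The approximating sequence is constant, so being Cauchy concerns the zero
    function. Its gradient is also a choice, and the case of factor 0 shows that its energy
    vanishes.\<close>
  moreover have "form \<rho> (\<lambda>y. 0) (\<lambda>y. 0) = 0"
    using form_eq_if_has_gradient(1)[OF cpt has_gradient_gromov_product[OF cpt, of \<rho> 0 b x]] by simp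
  ultimately have approx: "approximating \<rho> \<nu> {b} (\<lambda>n y. c * h y) f" and energy: "has_energy \<rho> \<nu> {b} f e"
    using gromov_product_in_killed_domain(1)[OF cpt \<nu>, of c b x \<rho>]
    by (auto simp: has_energy_def approximating_def form_Cauchy_def f_def h_def intro!: exI[of _ "\<lambda>n y. c * h y"])
  then have "f \<in> extended_domain \<rho> \<nu> {b}"
    unfolding extended_domain_def by (auto simp: f_def[abs_def])
  moreover have "(\<integral>\<^sup>+y. e2ennreal ((f y)\<^sup>2) \<partial>\<nu>) = 1"
  proof -
    have "(\<integral>\<^sup>+y. e2ennreal ((f y)\<^sup>2) \<partial>\<nu>) = (\<integral>\<^sup>+y. ennreal (c\<^sup>2 * (h y)\<^sup>2) \<partial>\<nu>)"
      by (simp add: f_def power_mult_distrib)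
    also have "\<dots> = ennreal (LINT y|\<nu>. c\<^sup>2 * (h y)\<^sup>2)"
      using int by (intro nn_integral_eq_integral) auto
    also have "\<dots> = 1"
      using \<open>N > 0\<close> by (simp add: c2 flip: N_def)
    finally show ?thesis .
  qed
  ultimately have "principal_eigenvalue \<rho> \<nu> {b} \<le> ennreal e"
    unfolding principal_eigenvalue_def using energy by (intro Inf_lower) blast
  then have "2 * principal_eigenvalue \<rho> \<nu> {b} \<le> 2 * ennreal e"
    by (rule mult_left_mono) simp
  also have "\<dots> = ennreal (d / N)"
    using \<open>N > 0\<close> \<open>d > 0\<close> by (simp add: e_def flip: ennreal_numeral ennreal_mult)
  also have "\<dots> \<le> ennreal (inverse (a * d))"
    using N \<open>N > 0\<close> \<open>d > 0\<close> \<open>a > 0\<close> by (intro ennreal_leI) (simp add: field_simps power2_eq_square)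
  also have "\<dots> = inverse (ennreal a * ennreal d)"
    using \<open>d > 0\<close> \<open>a > 0\<close> by (simp add: inverse_ennreal flip: ennreal_mult)
  finally show ?thesis by (simp add: a A_def[symmetric] d_def)
qed simp

theorem proposition5p3:
  fixes \<nu> :: "'a::real_tree measure" and \<rho> b :: 'a
  assumes "compact (UNIV :: 'a set)"
    and "radon_full_support \<nu>"
  shows "1 / (2 * ennreal (diameter (UNIV :: 'a set)) * emeasure \<nu> UNIV)
           \<le> principal_eigenvalue \<rho> \<nu> {b}
       \<and> principal_eigenvalue \<rho> \<nu> {b}
           \<le> 1/2 * (INF x\<in>UNIV - {b}.
                inverse (emeasure \<nu> {y. x \<in> tree_arc y b} * ennreal (dist x b)))"
proof
  let ?I = "INF x\<in>UNIV - {b}. inverse (emeasure \<nu> {y. x \<in> tree_arc y b} * ennreal (dist x b))"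
  have "2 * principal_eigenvalue \<rho> \<nu> {b} \<le> ?I"
    using principal_eigenvalue_upper_bound[OF assms] by (intro INF_greatest) auto
  then have "1/2 * (2 * principal_eigenvalue \<rho> \<nu> {b}) \<le> 1/2 * ?I"
    by (rule mult_left_mono) simp
  then show "principal_eigenvalue \<rho> \<nu> {b} \<le> 1/2 * ?I"
    by (simp add: mult.assoc[symmetric] ennreal_divide_times)
qed (rule principal_eigenvalue_lower_bound[OF assms])

end
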